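(* Let $\mathscr{M}$ be a von Neumann algebra acting on the Hilbert space $\mathcal{H}$. Let $T$ be a closed operator on $\mathcal{H}$ (not necessarily densely-defined). (i) $T$ is affiliated with $\mathscr{M}$ in the sense of Murray and von Neumann if and only if $T\in\mathscr{M}_{\mathrm{aff}}$; that is, $\mathscr{M}_{\mathrm{aff}}^{\mathrm{MvN}}=\mathscr{M}_{\mathrm{aff}}^{c}$. (ii) $T\in\mathscr{M}_{\mathrm{aff}}^{c}$ if and only if $T=P^{-1}AE^{\dagger}$ for operators $P,A,E\in\mathscr{M}$ with $P$ being a positive one-to-one operator with dense range, and $E$ a projection.
   Context: An unbounded operator on $\mathcal{H}$ is a linear map $T:\mathrm{dom}(T)\to\mathcal{H}$ with $\mathrm{dom}(T)$ a (not necessarily dense) linear subspace of $\mathcal{H}$, and $T$ not necessarily bounded; equality of operators includes equality of domains. $T$ is closed if its graph is closed in $\mathcal{H}\oplus\mathcal{H}$. For $A,B\in\mathcal{B}(\mathcal{H})$ with $\mathrm{null}(B)\subseteq\mathrm{null}(A)$, the quotient $A/B$ is the unbounded operator with domain $\mathrm{ran}(B)$ given by $Bx\mapsto Ax$ ($x\in\mathcal{H}$). $\mathscr{M}_{\mathrm{aff}} := \{A/B : A,B\in\mathscr{M},\ \mathrm{null}(B)\subseteq\mathrm{null}(A)\}$, and $\mathscr{M}_{\mathrm{aff}}^{c}$ is the set of closed operators in $\mathscr{M}_{\mathrm{aff}}$. $\mathscr{M}_{\mathrm{aff}}^{\mathrm{MvN}}$ is the set of closed operators $T$ on $\mathcal{H}$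 that are affiliated with $\mathscr{M}$ in the sense of Murray and von Neumann, i.e. $U^*TU=T$ for every unitary $U$ in the commutant $\mathscr{M}'$. Product: $\mathrm{dom}(ST)=\{x\in\mathrm{dom}(T): Tx\in\mathrm{dom}(S)\}$, $(ST)x=S(Tx)$. $P^{-1}$ is the inverse of $P$ with domain $\mathrm{ran}(P)$. For a projection $E$, $E^{\dagger}$ denotes the restriction of the identity operator to $\mathrm{ran}(E)$ (this is the Kaufman inverse of $E$). *)

theory Defs
  imports "HOL-Analysis.Analysis"
begin

section \<open>Complex Hilbert spaces\<close>

text \<open>
  A complex Hilbert space, of arbitrary dimension, is a real one with a compatible complex scalar
  multiplication and an inner product \<open>cinner\<close>, linear in the first variable, whose real part is
  the given real inner product. In particular \<open>cinner x x = of_real ((norm x)\<^sup>2)\<close>, see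
  \<open>cinner_self\<close> below.
\<close>

class complex_hilbert = real_inner + complete_space +
  fixes scaleC :: "complex \<Rightarrow> 'a \<Rightarrow> 'a" (infixr "*\<^sub>C" 75)
    and cinner :: "'a \<Rightarrow> 'a \<Rightarrow> complex"
  assumes scaleC_add_right: "c *\<^sub>C (x + y) = c *\<^sub>C x + c *\<^sub>C y"
    and scaleC_add_left: "(c + d) *\<^sub>C x = c *\<^sub>C x + d *\<^sub>C x"
    and scaleC_scaleC: "c *\<^sub>C d *\<^sub>C x = (c * d) *\<^sub>C x"
    and scaleC_of_real: "complex_of_real r *\<^sub>C x = r *\<^sub>R x"
    and cinner_add_left: "cinner (x + y) z = cinner x z + cinner y z"
    and cinner_scaleC_left: "cinner (c *\<^sub>C x) y = c * cinner x y"
    and cinner_commute: "cinner x y = cnj (cinner y x)"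
    and Re_cinner: "Re (cinner x y) = inner x y"

lemma cinner_self:
  fixes x :: "'a::complex_hilbert"
  shows "cinner x x = complex_of_real ((norm x)\<^sup>2)"
proof (rule complex_eqI)
  show "Re (cinner x x) = Re (complex_of_real ((norm x)\<^sup>2))"
    by (simp add: Re_cinner power2_norm_eq_inner)
  have "Im (cinner x x) = - Im (cinner x x)"
    by (subst cinner_commute) simp
  then show "Im (cinner x x) = Im (complex_of_real ((norm x)\<^sup>2))"
    by simp
qed

definition csubspace :: "'a::complex_hilbert set \<Rightarrow> bool" where
  "csubspace V \<longleftrightarrow>
     0 \<in> V \<and> (\<forall>x\<in>V. \<forall>y\<in>V. x + y \<in> V) \<and> (\<forall>c. \<forall>x\<in>V. c *\<^sub>C x \<in> V)"


section \<open>Bounded operators\<close>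

definition bounded_ops :: "('a::complex_hilbert \<Rightarrow> 'a) set" where
  "bounded_ops = {A. bounded_linear A \<and> (\<forall>c x. A (c *\<^sub>C x) = c *\<^sub>C A x)}"

definition cadjoint :: "('a::complex_hilbert \<Rightarrow> 'a) \<Rightarrow> 'a \<Rightarrow> 'a" where
  "cadjoint A = (THE B. \<forall>x y. cinner (A x) y = cinner x (B y))"

definition unitary_op :: "('a::complex_hilbert \<Rightarrow> 'a) \<Rightarrow> bool" where
  "unitary_op U \<longleftrightarrow> U \<in> bounded_ops \<and> cadjoint U \<circ> U = id \<and> U \<circ> cadjoint U = id"

definition positive_op :: "('a::complex_hilbert \<Rightarrow> 'a) \<Rightarrow> bool" where
  "positive_op P \<longleftrightarrow> P \<in> bounded_ops \<and> (\<forall>x. cinner (P x) x \<in> \<real>\<^sub>\<ge>\<^sub>0)"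

definition projection_op :: "('a::complex_hilbert \<Rightarrow> 'a) \<Rightarrow> bool" where
  "projection_op E \<longleftrightarrow> E \<in> bounded_ops \<and> E \<circ> E = E \<and> cadjoint E = E"

definition null_space :: "('a::complex_hilbert \<Rightarrow> 'a) \<Rightarrow> 'a set" where
  "null_space A = {x. A x = 0}"


section \<open>Von Neumann algebras\<close>

text \<open>
  The topology of \<open>'a \<times> 'a \<Rightarrow> complex\<close> is that of pointwise convergence, so this is the coarsest
  topology on the bounded operators making all the maps \<open>\<lambda>A. cinner (A x) y\<close> continuous.
\<close>

definition weak_op_topology :: "('a::complex_hilbert \<Rightarrow> 'a) topology" where
  "weak_op_topology = pullback_topology bounded_ops (\<lambda>A (x, y). cinner (A x) y) euclidean"

definition von_neumann_algebra :: "('a::complex_hilbert \<Rightarrow> 'a) set \<Rightarrow> bool" where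
  "von_neumann_algebra M \<longleftrightarrow>
     M \<subseteq> bounded_ops \<and> id \<in> M \<and>
     (\<forall>A\<in>M. \<forall>B\<in>M. (\<lambda>x. A x + B x) \<in> M) \<and>
     (\<forall>c. \<forall>A\<in>M. (\<lambda>x. c *\<^sub>C A x) \<in> M) \<and>
     (\<forall>A\<in>M. \<forall>B\<in>M. A \<circ> B \<in> M) \<and>
     (\<forall>A\<in>M. cadjoint A \<in> M) \<and>
     closedin weak_op_topology M"

definition commutant :: "('a::complex_hilbert \<Rightarrow> 'a) set \<Rightarrow> ('a \<Rightarrow> 'a) set" where
  "commutant M = {B \<in> bounded_ops. \<forall>A\<in>M. A \<circ> B = B \<circ> A}"


section \<open>Unbounded operators\<close>

text \<open>
  An unbounded operator is a partial function \<open>T :: 'a \<rightharpoonup> 'a\<close> with domain \<open>dom T\<close>; equality of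
  partial functions includes equality of domains. The product \<open>ST\<close> of operators is the composition
  \<open>S \<circ>\<^sub>m T\<close> of partial functions, which is defined at \<open>x\<close> exactly if \<open>x \<in> dom T\<close> and
  \<open>the (T x) \<in> dom S\<close>.
\<close>

definition unbounded_op :: "('a::complex_hilbert \<rightharpoonup> 'a) \<Rightarrow> bool" where
  "unbounded_op T \<longleftrightarrow>
     csubspace (dom T) \<and>
     (\<forall>x\<in>dom T. \<forall>y\<in>dom T. the (T (x + y)) = the (T x) + the (T y)) \<and>
     (\<forall>c. \<forall>x\<in>dom T. the (T (c *\<^sub>C x)) = c *\<^sub>C the (T x))"

definition closed_op :: "('a::complex_hilbert \<rightharpoonup> 'a) \<Rightarrow> bool" where
  "closed_op T \<longleftrightarrow> unbounded_op T \<and> closed (Map.graph T)"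

definition total_op :: "('a \<Rightarrow> 'a) \<Rightarrow> ('a \<rightharpoonup> 'a)" where
  "total_op A = (\<lambda>x. Some (A x))"

text \<open>
  \<open>quotient_op A B\<close> maps \<open>B x\<close> to \<open>A x\<close>. The choice of a preimage in \<open>inv B\<close> is immaterial
  under the condition on null spaces in \<open>affiliated_ops\<close>, see \<open>quotient_op_apply\<close> below.
\<close>

definition quotient_op :: "('a::complex_hilbert \<Rightarrow> 'a) \<Rightarrow> ('a \<Rightarrow> 'a) \<Rightarrow> ('a \<rightharpoonup> 'a)" where
  "quotient_op A B = (\<lambda>y. if y \<in> range B then Some (A (inv B y)) else None)"

lemma dom_quotient_op: "dom (quotient_op A B) = range B"
  by (auto simp: quotient_op_def dom_def)

lemma quotient_op_apply:
  assumes "A \<in> bounded_ops" "B \<in> bounded_ops" "null_space B \<subseteq> null_space A"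
  shows "quotient_op A B (B x) = Some (A x)"
proof -
  interpret A: bounded_linear A using assms(1) by (simp add: bounded_ops_def)
  interpret B: bounded_linear B using assms(2) by (simp add: bounded_ops_def)
  have "B (inv B (B x) - x) = 0"
    by (simp add: B.diff f_inv_into_f)
  then have "A (inv B (B x) - x) = 0"
    using assms(3) by (auto simp: null_space_def)
  then show ?thesis
    by (simp add: quotient_op_def A.diff)
qed

definition inverse_op :: "('a::complex_hilbert \<Rightarrow> 'a) \<Rightarrow> ('a \<rightharpoonup> 'a)" where
  "inverse_op P = (\<lambda>y. if y \<in> range P then Some (inv P y) else None)"

definition kaufman_inverse_proj :: "('a::complex_hilbert \<Rightarrow> 'a) \<Rightarrow> ('a \<rightharpoonup> 'a)" where
  "kaufman_inverse_proj E = Some |` range E"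


section \<open>Affiliated operators\<close>

definition affiliated_ops :: "('a::complex_hilbert \<Rightarrow> 'a) set \<Rightarrow> ('a \<rightharpoonup> 'a) set" where
  "affiliated_ops M =
     {quotient_op A B |A B. A \<in> M \<and> B \<in> M \<and> null_space B \<subseteq> null_space A}"

definition closed_affiliated_ops :: "('a::complex_hilbert \<Rightarrow> 'a) set \<Rightarrow> ('a \<rightharpoonup> 'a) set" where
  "closed_affiliated_ops M = {T \<in> affiliated_ops M. closed_op T}"

definition mvn_affiliated :: "('a::complex_hilbert \<Rightarrow> 'a) set \<Rightarrow> ('a \<rightharpoonup> 'a) \<Rightarrow> bool" where
  "mvn_affiliated M T \<longleftrightarrow>
     (\<forall>U\<in>commutant M. unitary_op U \<longrightarrow> total_op (cadjoint U) \<circ>\<^sub>m T \<circ>\<^sub>m total_op U = T)"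

definition mvn_affiliated_ops :: "('a::complex_hilbert \<Rightarrow> 'a) set \<Rightarrow> ('a \<rightharpoonup> 'a) set" where
  "mvn_affiliated_ops M = {T. closed_op T \<and> mvn_affiliated M T}"

end

theory Submission
  imports Defs
begin

text \<open>
  Let \<open>G\<close> be the graph of the closed operator \<open>T\<close>, a closed subspace of the sum of two copies of the
  Hilbert space, and let \<open>p\<^sub>i\<^sub>j\<close> be the matrix entries of the orthogonal projection onto \<open>G\<close>. If \<open>T\<close> is
  affiliated with \<open>M\<close> in the sense of Murray and von Neumann, then the \<open>p\<^sub>i\<^sub>j\<close> commute with the unitaries of
  the commutant. By the Cayley transform they commute with the whole commutant, so they lie in \<open>M\<close> by
  the double commutant theorem.

  A pair \<open>(x, y)\<close> with \<open>x \<in> closure (dom T)\<close> lies in \<open>G\<close> iff the second component of its difference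
  from its projection onto \<open>G\<close> vanishes, that is, \<open>(1 - p\<^sub>2\<^sub>2) y = p\<^sub>2\<^sub>1 x\<close>. So \<open>T = P\<^sup>-\<^sup>1 A E\<^sup>\<dagger>\<close> with \<open>P = 1 - p\<^sub>2\<^sub>2\<close>, \<open>A = p\<^sub>2\<^sub>1\<close> and \<open>E\<close> the
  projection onto \<open>closure (dom T)\<close>.

  For the quotient, let \<open>B\<close> be a self-adjoint square root of \<open>p\<^sub>1\<^sub>1\<close>. The projection of \<open>(z, 0)\<close> onto
  \<open>G\<close> has norm \<open>norm (B z)\<close>, and these projections are dense in \<open>G\<close>, because an element of \<open>G\<close> orthogonal
  to all of them has first component \<open>0\<close>. Passing to limits, \<open>range B = dom T\<close> and \<open>T B\<close> is a
  contraction, and \<open>T = (T B) / B\<close>.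
\<close>

section \<open>Orthogonal projections and adjoints\<close>

text \<open>First variation: for small \<open>t\<close> with the sign of \<open>s\<close>, the
  linear term outgrows the quadratic one. This turns minimality of a distance into
  orthogonality.\<close>

lemma eq_zero_if_quadratic_bound:
  fixes s q :: real
  assumes "\<And>t. 2 * t * s \<le> t\<^sup>2 * q" "q \<ge> 0"
  shows "s = 0"
proof (rule ccontr)
  assume "s \<noteq> 0"
  \<comment> \<open>The bound is used at \<open>t = s / (q + 1)\<close>; the summand 1 keeps the
    denominator positive when \<open>q\<close> is 0.\<close>
  have "2 * (s / (q + 1)) * s * (q + 1)\<^sup>2 \<le> (s / (q + 1))\<^sup>2 * q * (q + 1)\<^sup>2"
    by (intro mult_right_mono assms(1)) simp
  then have "2 * s\<^sup>2 * (q + 1) \<le> s\<^sup>2 * q"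
    using assms(2) by (simp add: power2_eq_square mult_ac)
  then have "s\<^sup>2 * (q + 2) \<le> 0"
    by (simp add: algebra_simps)
  then show False
    using \<open>s \<noteq> 0\<close> assms(2) by (simp add: mult_le_0_iff)
qed

text \<open>A minimising sequence for the distance to \<open>u\<close> is Cauchy by the
  parallelogram law. Families over \<open>I\<close> encode the Hilbert sum; the last hypothesis says
  that \<open>V\<close> is closed and also that membership depends only on the coordinates in
  \<open>I\<close>.\<close>

lemma projection_exists_sum:
  fixes V :: "('i \<Rightarrow> 'a::{real_inner,complete_space}) set"
  assumes fin: "finite I"
    and zero: "(\<lambda>_. 0) \<in> V"
    and add: "\<And>v w. v \<in> V \<Longrightarrow> w \<in> V \<Longrightarrow> (\<lambda>i. v i + w i) \<in> V"
    and scale: "\<And>r v. v \<in> V \<Longrightarrow> (\<lambda>i. r *\<^sub>R v i) \<in> V"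
    and lim: "\<And>X v. (\<And>n. X n \<in> V) \<Longrightarrow> (\<And>i. i \<in> I \<Longrightarrow> (\<lambda>n. X n i) \<longlonglongrightarrow> v i) \<Longrightarrow> v \<in> V"
  obtains v where "v \<in> V" "\<And>w. w \<in> V \<Longrightarrow> (\<Sum>i\<in>I. inner (u i - v i) (w i)) = 0"
proof -
  define N :: "('i \<Rightarrow> 'a) \<Rightarrow> real" where "N v = (\<Sum>i\<in>I. (norm (v i))\<^sup>2)" for v
  define D where "D v = N (\<lambda>i. u i - v i)" for v
  define d where "d = Inf (D ` V)"
  have N_nonneg: "0 \<le> N v" for v
    by (simp add: N_def sum_nonneg)
  have d_le: "d \<le> D v" if "v \<in> V" for v
    unfolding d_def D_def using that N_nonneg by (intro cInf_lower bdd_belowI[of _ 0]) auto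
  have "\<exists>v\<in>V. D v < d + 1 / Suc n" for n
  proof -
    have "d < d + 1 / Suc n" by simp
    then show ?thesis
      unfolding d_def by (subst (asm) cInf_less_iff) (use zero N_nonneg in \<open>auto simp: D_def intro!: bdd_belowI[of _ 0]\<close>)
  qed
  then obtain X where X: "\<And>n. X n \<in> V" "\<And>n. D (X n) < d + 1 / Suc n"
    by metis
  have parallelogram: "N (\<lambda>i. v i - w i) \<le> 2 * D v + 2 * D w - 4 * d" if "v \<in> V" "w \<in> V" for v w
  proof -
    \<comment> \<open>Parallelogram law, used with \<open>c = u i\<close>; the midpoint of
      \<open>v\<close> and \<open>w\<close> lies in \<open>V\<close>, so its squared distance to
      \<open>u\<close> is at least \<open>d\<close>.\<close>
    have "(norm (a - b))\<^sup>2 = 2 * (norm (c - a))\<^sup>2 + 2 * (norm (c - b))\<^sup>2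
        - 4 * (norm (c - (1/2) *\<^sub>R (a + b)))\<^sup>2" for a b c :: 'a
      by (simp add: power2_norm_eq_inner algebra_simps inner_commute)
    then have "N (\<lambda>i. v i - w i) = 2 * D v + 2 * D w - 4 * D (\<lambda>i. (1/2) *\<^sub>R (v i + w i))"
      unfolding N_def D_def sum_distrib_left sum.distrib[symmetric] sum_subtractf[symmetric]
      by (intro sum.cong refl)
    moreover have "d \<le> D (\<lambda>i. (1/2) *\<^sub>R (v i + w i))"
      by (intro d_le scale add that)
    ultimately show ?thesis by simp
  qed
  have "Cauchy (\<lambda>n. X n i)" if "i \<in> I" for i
  proof (rule metric_CauchyI)
    fix e :: real assume "e > 0"
    \<comment> \<open>Two values exceeding \<open>d\<close> by less than
      \<open>e\<^sup>2 / 4\<close>, each counted twice in \<open>parallelogram\<close>, give less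
      than \<open>e\<^sup>2\<close>.\<close>
    then obtain k where k: "inverse (Suc k) < e\<^sup>2 / 4"
      using reals_Archimedean[of "e\<^sup>2 / 4"] by auto
    show "\<exists>k. \<forall>m\<ge>k. \<forall>n\<ge>k. dist (X m i) (X n i) < e"
    proof (intro exI allI impI)
      fix m n assume mn: "m \<ge> k" "n \<ge> k"
      have *: "D (X p) < d + e\<^sup>2 / 4" if "p \<ge> k" for p
      proof -
        have "1 / Suc p \<le> inverse (Suc k)"
          using that by (simp add: field_simps)
        then show ?thesis using X(2)[of p] k by linarith
      qed
      have "(dist (X m i) (X n i))\<^sup>2 \<le> N (\<lambda>i. X m i - X n i)"
        unfolding N_def dist_norm by (rule member_le_sum[OF that]) (auto simp: fin)
      also have "\<dots> < e\<^sup>2"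
        using parallelogram[OF X(1) X(1), of m n] *[OF mn(1)] *[OF mn(2)] by simp
      finally show "dist (X m i) (X n i) < e"
        using \<open>e > 0\<close> by (simp add: power2_less_imp_less)
    qed
  qed
  then obtain v where v: "\<And>i. i \<in> I \<Longrightarrow> (\<lambda>n. X n i) \<longlonglongrightarrow> v i"
    unfolding Cauchy_convergent_iff convergent_def by metis
  have "v \<in> V" using lim X(1) v by blast
  have "(\<lambda>n. D (X n)) \<longlonglongrightarrow> D v"
    unfolding D_def N_def by (intro tendsto_intros v)
  moreover have "(\<lambda>n. d + 1 / Suc n) \<longlonglongrightarrow> d + 0"
    by (intro tendsto_intros LIMSEQ_Suc lim_1_over_n)
  ultimately have "D v \<le> d + 0"
    by (rule LIMSEQ_le) (use X(2) less_imp_le in blast)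
  show thesis
  proof
    show "v \<in> V" by fact
    fix w assume w: "w \<in> V"
    show "(\<Sum>i\<in>I. inner (u i - v i) (w i)) = 0"
    proof (rule eq_zero_if_quadratic_bound[OF _ N_nonneg])
      fix t :: real
      \<comment> \<open>Moving the minimiser along \<open>w\<close> cannot decrease the distance;
        expanding the squares leaves the bound required by
        \<open>eq_zero_if_quadratic_bound\<close>.\<close>
      have "D v \<le> D (\<lambda>i. v i + t *\<^sub>R w i)"
        using d_le[OF add[OF \<open>v \<in> V\<close> scale[OF w]], of t] \<open>D v \<le> d + 0\<close> by simp
      also have "\<dots> = (\<Sum>i\<in>I. (norm (u i - v i))\<^sup>2 - 2 * t * inner (u i - v i) (w i) + t\<^sup>2 * (norm (w i))\<^sup>2)"
        unfolding D_def N_def power2_norm_eq_inner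
        by (intro sum.cong refl) (simp add: algebra_simps inner_commute power2_eq_square)
      also have "\<dots> = D v - 2 * t * (\<Sum>i\<in>I. inner (u i - v i) (w i)) + t\<^sup>2 * N w"
        by (simp add: D_def N_def sum.distrib sum_subtractf sum_distrib_left)
      finally show "2 * t * (\<Sum>i\<in>I. inner (u i - v i) (w i)) \<le> t\<^sup>2 * N w" by simp
    qed
  qed
qed

lemma projection_exists:
  fixes S :: "'a::{real_inner,complete_space} set"
  assumes "closed S" "subspace S"
  obtains v where "v \<in> S" "\<And>w. w \<in> S \<Longrightarrow> inner (u - v) w = 0"
proof -
  have lim: "v \<in> {v. v () \<in> S}"
    if "\<And>n. X n \<in> {v. v () \<in> S}" "\<And>i. i \<in> {()} \<Longrightarrow> (\<lambda>n. X n i) \<longlonglongrightarrow> v i" for X :: "nat \<Rightarrow> unit \<Rightarrow> 'a" and v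
    using that closed_sequentially[OF assms(1), of "\<lambda>n. X n ()" "v ()"] by simp
  obtain v where "v \<in> {v. v () \<in> S}"
    "\<And>w. w \<in> {v. v () \<in> S} \<Longrightarrow> (\<Sum>i\<in>{()}. inner (u - v i) (w i)) = 0"
    by (rule projection_exists_sum[of "{()}" "{v. v () \<in> S}" "\<lambda>_. u", OF _ _ _ _ lim])
      (use assms in \<open>auto simp: subspace_def\<close>)
  then show thesis by (intro that[of "v ()"]) auto
qed

lemma subspace_closure:
  fixes S :: "'a::real_normed_vector set"
  assumes "subspace S"
  shows "subspace (closure S)"
  unfolding subspace_def
proof (intro conjI ballI allI)
  show "0 \<in> closure S"
    using assms closure_subset subspace_0 by blast
  show "x + y \<in> closure S" if xy: "x \<in> closure S" "y \<in> closure S" for x y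
  proof -
    obtain X Y where "\<And>n. X n \<in> S" "X \<longlonglongrightarrow> x" "\<And>n. Y n \<in> S" "Y \<longlonglongrightarrow> y"
      using xy unfolding closure_sequential by blast
    then show ?thesis
      unfolding closure_sequential
      by (intro exI[of _ "\<lambda>n. X n + Y n"]) (auto intro: tendsto_add subspace_add[OF assms])
  qed
  show "c *\<^sub>R x \<in> closure S" if x: "x \<in> closure S" for c x
  proof -
    obtain X where "\<And>n. X n \<in> S" "X \<longlonglongrightarrow> x"
      using x unfolding closure_sequential by blast
    then show ?thesis
      unfolding closure_sequential
      by (intro exI[of _ "\<lambda>n. c *\<^sub>R X n"]) (auto intro: tendsto_scaleR subspace_scale[OF assms])
  qed
qed

text \<open>The difference of a point from its projection onto \<open>closure S\<close> is
  orthogonal to \<open>S\<close>, hence 0.\<close>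

lemma closure_UNIV_if_orthogonal_zero:
  fixes S :: "'a::{real_inner,complete_space} set"
  assumes "subspace S" "\<And>x. (\<And>w. w \<in> S \<Longrightarrow> inner x w = 0) \<Longrightarrow> x = 0"
  shows "closure S = UNIV"
proof (intro set_eqI iffI UNIV_I)
  fix u
  obtain v where v: "v \<in> closure S" "\<And>w. w \<in> closure S \<Longrightarrow> inner (u - v) w = 0"
    using projection_exists[of "closure S" u] assms(1) by (metis closed_closure subspace_closure)
  then have "u - v = 0" using assms(2) closure_subset by blast
  then show "u \<in> closure S" using v(1) by simp
qed

text \<open>If \<open>f\<close> is not 0, take a vector \<open>y\<close> outside the kernel and
  orthogonal to it. Every \<open>x\<close> is a multiple of \<open>y\<close> up to the kernel, so a
  multiple of \<open>y\<close> represents \<open>f\<close>.\<close>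

lemma riesz_representation_exists:
  fixes f :: "'a::{real_inner,complete_space} \<Rightarrow> real"
  assumes "bounded_linear f"
  shows "\<exists>z. \<forall>x. f x = inner x z"
proof (cases "\<forall>x. f x = 0")
  case True
  then show ?thesis by (intro exI[of _ 0]) simp
next
  case False
  then obtain u where u: "f u \<noteq> 0" by blast
  interpret f: bounded_linear f by fact
  have "closed {x. f x = 0}"
    by (intro closed_Collect_eq continuous_intros f.continuous_on)
  moreover have "subspace {x. f x = 0}"
    by (auto simp: subspace_def f.add f.scaleR f.zero)
  ultimately obtain v where v: "f v = 0" "\<And>w. f w = 0 \<Longrightarrow> inner (u - v) w = 0"
    using projection_exists[of "{x. f x = 0}" u] by auto
  define y where "y = u - v"
  have fy: "f y \<noteq> 0" using u v by (simp add: y_def f.diff)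
  then have "y \<noteq> 0" using f.zero by auto
  have "f x = inner x ((f y / inner y y) *\<^sub>R y)" for x
  proof -
    have "f (x - (f x / f y) *\<^sub>R y) = 0"
      using fy by (simp add: f.diff f.scaleR)
    then have "inner y (x - (f x / f y) *\<^sub>R y) = 0"
      using v(2) by (simp add: y_def)
    then have "inner y x * f y = f x * inner y y"
      using fy by (simp add: inner_diff_right field_simps)
    then show ?thesis
      using \<open>y \<noteq> 0\<close> by (simp add: field_simps inner_commute)
  qed
  then show ?thesis by blast
qed

section \<open>Complex scalars and the real inner product\<close>

lemma scaleC_simps [simp]:
  fixes x :: "'a::complex_hilbert"
  shows "c *\<^sub>C (0::'a) = 0" "0 *\<^sub>C x = 0" "1 *\<^sub>C x = x" "(- c) *\<^sub>C x = - (c *\<^sub>C x)" "c *\<^sub>C (- x) = - (c *\<^sub>C x)"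
proof -
  show 0: "c *\<^sub>C (0::'a) = 0" for c
    using scaleC_add_right[of c "0::'a" 0] by simp
  show "1 *\<^sub>C x = x" using scaleC_of_real[of 1 x] by simp
  show 1: "0 *\<^sub>C x = 0" for x :: 'a using scaleC_of_real[of 0 x] by simp
  show "(- c) *\<^sub>C x = - (c *\<^sub>C x)"
    using scaleC_add_left[of "-c" c x] 1 by (simp add: eq_neg_iff_add_eq_0)
  show "c *\<^sub>C (- x) = - (c *\<^sub>C x)"
    using scaleC_add_right[of c "-x" x] 0 by (simp add: eq_neg_iff_add_eq_0)
qed

lemma scaleC_diff_right: "c *\<^sub>C (x - y) = c *\<^sub>C x - c *\<^sub>C (y::'a::complex_hilbert)"
  using scaleC_add_right[of c x "-y"] by simp

lemma scaleR_scaleC_commute: "r *\<^sub>R (c *\<^sub>C x) = c *\<^sub>C (r *\<^sub>R (x::'a::complex_hilbert))"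
  by (simp flip: scaleC_of_real add: scaleC_scaleC mult.commute)

lemma inner_i_left: "inner (\<i> *\<^sub>C x) y = - Im (cinner x (y::'a::complex_hilbert))"
  by (simp flip: Re_cinner add: cinner_scaleC_left)

lemma cinner_scaleC_right: "cinner x (c *\<^sub>C y) = cnj c * cinner x (y::'a::complex_hilbert)"
  by (subst (1 2) cinner_commute) (simp add: cinner_scaleC_left)

lemma inner_scaleC_left: "inner (c *\<^sub>C x) y = inner x (cnj c *\<^sub>C (y::'a::complex_hilbert))"
  by (simp flip: Re_cinner add: cinner_scaleC_left cinner_scaleC_right)

lemma norm_scaleC: "norm (c *\<^sub>C x) = cmod c * norm (x::'a::complex_hilbert)"
proof -
  have "complex_of_real ((norm (c *\<^sub>C x))\<^sup>2) = c * cnj c * complex_of_real ((norm x)\<^sup>2)"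
    unfolding cinner_self[symmetric] by (simp add: cinner_scaleC_left cinner_scaleC_right)
  also have "\<dots> = complex_of_real ((cmod c * norm x)\<^sup>2)"
    by (simp add: complex_norm_square power_mult_distrib flip: of_real_power)
  finally have "(norm (c *\<^sub>C x))\<^sup>2 = (cmod c * norm x)\<^sup>2"
    using of_real_eq_iff by blast
  then show ?thesis by (simp add: power2_eq_iff_nonneg)
qed

lemma bounded_linear_scaleC: "bounded_linear (\<lambda>x::'a::complex_hilbert. c *\<^sub>C x)"
  by (rule bounded_linear_intro[of _ "cmod c"])
    (auto simp: scaleC_add_right scaleR_scaleC_commute norm_scaleC)

section \<open>Bounded operators and their adjoints\<close>

lemma bounded_opsI:
  assumes "\<And>x y. A (x + y) = A x + A y" "\<And>c x. A (c *\<^sub>C x) = c *\<^sub>C A x" "\<And>x. norm (A x) \<le> norm x * K"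
  shows "A \<in> bounded_ops"
  unfolding bounded_ops_def using assms
  by (auto intro!: bounded_linear_intro[of A K] simp flip: scaleC_of_real)

lemma bounded_opsD:
  assumes "A \<in> bounded_ops"
  shows "bounded_linear A" "A (x + y) = A x + A y" "A (x - y) = A x - A y" "A (- x) = - A x"
    "A 0 = 0" "A (r *\<^sub>R x) = r *\<^sub>R A x" "A (c *\<^sub>C x) = c *\<^sub>C A x"
proof -
  show "bounded_linear A" using assms by (simp add: bounded_ops_def)
  then interpret bounded_linear A .
  show "A (x + y) = A x + A y" "A (x - y) = A x - A y" "A (- x) = - A x"
    "A 0 = 0" "A (r *\<^sub>R x) = r *\<^sub>R A x" "A (c *\<^sub>C x) = c *\<^sub>C A x"
    using assms by (simp_all add: add diff neg zero scaleR bounded_ops_def)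
qed

lemma bounded_ops_id [simp]: "id \<in> bounded_ops"
  by (rule bounded_opsI[of _ 1]) auto

lemma bounded_ops_scaleC: "(\<lambda>x. c *\<^sub>C x) \<in> bounded_ops"
  using bounded_linear_scaleC by (auto simp: bounded_ops_def scaleC_scaleC mult.commute)

lemma bounded_ops_comp: "A \<in> bounded_ops \<Longrightarrow> B \<in> bounded_ops \<Longrightarrow> A \<circ> B \<in> bounded_ops"
  using bounded_linear_compose[of A B] by (auto simp: bounded_ops_def o_def)

lemma bounded_ops_add: "A \<in> bounded_ops \<Longrightarrow> B \<in> bounded_ops \<Longrightarrow> (\<lambda>x. A x + B x) \<in> bounded_ops"
  using bounded_linear_add[of A B] by (auto simp: bounded_ops_def scaleC_add_right)

lemma bounded_ops_diff: "A \<in> bounded_ops \<Longrightarrow> B \<in> bounded_ops \<Longrightarrow> (\<lambda>x. A x - B x) \<in> bounded_ops"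
  using bounded_linear_sub[of A B] by (auto simp: bounded_ops_def scaleC_diff_right)

text \<open>The imaginary part of \<open>cinner\<close> is, up to sign, the real inner product after
  multiplying the first argument by \<i>. So for complex linear \<open>A\<close>, adjoints can be
  checked with the real inner product alone.\<close>

lemma cinner_adjoint_if_inner_adjoint:
  assumes "A \<in> bounded_ops" "\<And>x y. inner (A x) y = inner x (B y)"
  shows "cinner (A x) y = cinner x (B y)"
proof (rule complex_eqI)
  show "Re (cinner (A x) y) = Re (cinner x (B y))"
    by (simp add: Re_cinner assms(2))
  have "inner (\<i> *\<^sub>C A x) y = inner (\<i> *\<^sub>C x) (B y)"
    using assms(2)[of "\<i> *\<^sub>C x" y] bounded_opsD(7)[OF assms(1)] by simp
  then show "Im (cinner (A x) y) = Im (cinner x (B y))"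
    by (simp add: inner_i_left)
qed

lemma cadjoint_eqI:
  assumes "A \<in> bounded_ops" "\<And>x y. inner (A x) y = inner x (B y)"
  shows "cadjoint A = B"
  unfolding cadjoint_def
proof (rule the_equality)
  show "\<forall>x y. cinner (A x) y = cinner x (B y)"
    using cinner_adjoint_if_inner_adjoint[OF assms] by blast
  fix C assume "\<forall>x y. cinner (A x) y = cinner x (C y)"
  then have "inner x (C y) = inner x (B y)" for x y
    by (metis Re_cinner assms(2))
  then show "C = B" by (metis ext vector_eq_ldot)
qed

text \<open>Riesz representation supplies an adjoint pointwise, and \<open>cadjoint_eqI\<close>
  identifies it with the definite description in \<open>cadjoint\<close>.\<close>

lemma inner_cadjoint:
  assumes "A \<in> bounded_ops"
  shows "inner (A x) y = inner x (cadjoint A y)"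
proof -
  have "\<exists>z. \<forall>x. inner (A x) y = inner x z" for y
    by (rule riesz_representation_exists)
      (intro bounded_linear_compose[OF bounded_linear_inner_left] bounded_opsD(1) assms)
  then obtain B where B: "\<And>x y. inner (A x) y = inner x (B y)" by metis
  with cadjoint_eqI[OF assms B] show ?thesis by simp
qed

lemma inner_cadjoint': "A \<in> bounded_ops \<Longrightarrow> inner (cadjoint A x) y = inner x (A y)"
  by (metis inner_cadjoint inner_commute)

lemma cadjoint_bounded_ops:
  assumes "A \<in> bounded_ops"
  shows "cadjoint A \<in> bounded_ops"
proof -
  note [simp] = inner_cadjoint[OF assms, symmetric]
  interpret A: bounded_linear A using assms by (rule bounded_opsD)
  obtain K where K: "\<And>x. norm (A x) \<le> norm x * K" using A.bounded by blast
  show ?thesis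
  proof (rule bounded_opsI)
    show "cadjoint A (x + y) = cadjoint A x + cadjoint A y" for x y
      by (subst vector_eq_ldot[symmetric]) (simp add: inner_add_right)
    show "cadjoint A (c *\<^sub>C x) = c *\<^sub>C cadjoint A x" for c x
    proof (subst vector_eq_ldot[symmetric], rule allI)
      fix z
      have "inner z (c *\<^sub>C cadjoint A x) = inner (cnj c *\<^sub>C z) (cadjoint A x)"
        by (simp add: inner_scaleC_left del: inner_cadjoint[OF assms, symmetric])
      then show "inner z (cadjoint A (c *\<^sub>C x)) = inner z (c *\<^sub>C cadjoint A x)"
        by (simp add: bounded_opsD(7)[OF assms] inner_scaleC_left)
    qed
    show "norm (cadjoint A x) \<le> norm x * K" for x
    proof -
      have "(norm (cadjoint A x))\<^sup>2 = inner (A (cadjoint A x)) x"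
        by (simp only: power2_norm_eq_inner inner_cadjoint[OF assms])
      also have "\<dots> \<le> norm (A (cadjoint A x)) * norm x" by (rule norm_cauchy_schwarz)
      also have "\<dots> \<le> norm (cadjoint A x) * K * norm x" by (intro mult_right_mono K) simp
      finally show ?thesis
        using order_trans[OF norm_ge_zero K[of x]]
        by (cases "cadjoint A x = 0") (auto simp: power2_eq_square mult_ac)
    qed
  qed
qed

lemma cadjoint_cadjoint: "A \<in> bounded_ops \<Longrightarrow> cadjoint (cadjoint A) = A"
  by (intro cadjoint_eqI cadjoint_bounded_ops inner_cadjoint')

lemma cadjoint_scaleC: "cadjoint (\<lambda>x::'a::complex_hilbert. c *\<^sub>C x) = (\<lambda>x. cnj c *\<^sub>C x)"
  by (rule cadjoint_eqI[OF bounded_ops_scaleC inner_scaleC_left])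

lemma subspace_if_csubspace: "csubspace S \<Longrightarrow> subspace S"
  unfolding subspace_def csubspace_def scaleC_of_real[symmetric] by blast

lemma csubspace_closure:
  assumes "csubspace S"
  shows "csubspace (closure S)"
  unfolding csubspace_def
proof (intro conjI ballI allI)
  have "subspace (closure S)" by (intro subspace_closure subspace_if_csubspace assms)
  then show "0 \<in> closure S" "\<And>x y. x \<in> closure S \<Longrightarrow> y \<in> closure S \<Longrightarrow> x + y \<in> closure S"
    by (auto simp: subspace_def)
  show "c *\<^sub>C x \<in> closure S" if x: "x \<in> closure S" for c x
  proof -
    obtain X where X: "\<And>n. X n \<in> S" "X \<longlonglongrightarrow> x"
      using x unfolding closure_sequential by blast
    have "(\<lambda>n. c *\<^sub>C X n) \<longlonglongrightarrow> c *\<^sub>C x"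
      by (rule bounded_linear.tendsto[OF bounded_linear_scaleC X(2)])
    moreover have "c *\<^sub>C X n \<in> S" for n
      using X(1) assms by (simp add: csubspace_def)
    ultimately show ?thesis
      unfolding closure_sequential by (intro exI[of _ "\<lambda>n. c *\<^sub>C X n"]) simp
  qed
qed

section \<open>Projections in finite Hilbert sums\<close>

text \<open>
  \<open>V\<close> is a closed subspace of the Hilbert sum of copies of \<open>'a\<close> indexed by \<open>I\<close>. The operators
  \<open>entry i j\<close> below are the matrix entries of the orthogonal projection onto \<open>V\<close>. Values of
  families outside \<open>I\<close> are irrelevant, so uniqueness statements only concern indices in \<open>I\<close>.
\<close>

locale closed_subspace_of_sum =
  fixes I :: "'i set" and V :: "('i \<Rightarrow> 'a::complex_hilbert) set"
  assumes fin: "finite I"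
    and zero_in: "(\<lambda>_. 0) \<in> V"
    and add_in: "\<And>v w. v \<in> V \<Longrightarrow> w \<in> V \<Longrightarrow> (\<lambda>i. v i + w i) \<in> V"
    and scale_in: "\<And>c v. v \<in> V \<Longrightarrow> (\<lambda>i. c *\<^sub>C v i) \<in> V"
    and lim_in: "\<And>X v. (\<And>n. X n \<in> V) \<Longrightarrow> (\<And>i. i \<in> I \<Longrightarrow> (\<lambda>n. X n i) \<longlonglongrightarrow> v i) \<Longrightarrow> v \<in> V"
begin

text \<open>\<open>SOME\<close> rather than \<open>THE\<close>, because orthogonality does not
  determine the values off \<open>I\<close>.\<close>

definition proj :: "('i \<Rightarrow> 'a) \<Rightarrow> 'i \<Rightarrow> 'a" where
  "proj u = (SOME v. v \<in> V \<and> (\<forall>w\<in>V. (\<Sum>i\<in>I. inner (u i - v i) (w i)) = 0))"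

lemma proj_in: "proj u \<in> V"
  and proj_orth: "w \<in> V \<Longrightarrow> (\<Sum>i\<in>I. inner (u i - proj u i) (w i)) = 0"
proof -
  have "\<exists>v. v \<in> V \<and> (\<forall>w\<in>V. (\<Sum>i\<in>I. inner (u i - v i) (w i)) = 0)"
  proof (rule projection_exists_sum[of I V u])
    show "(\<lambda>i. r *\<^sub>R v i) \<in> V" if "v \<in> V" for r v
      using scale_in[OF that, of "of_real r"] by (simp add: scaleC_of_real)
  qed (use fin zero_in add_in lim_in in blast)+
  then have "proj u \<in> V \<and> (\<forall>w\<in>V. (\<Sum>i\<in>I. inner (u i - proj u i) (w i)) = 0)"
    unfolding proj_def by (rule someI_ex)
  then show "proj u \<in> V" "w \<in> V \<Longrightarrow> (\<Sum>i\<in>I. inner (u i - proj u i) (w i)) = 0" by blast+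
qed

text \<open>The difference of two candidates lies in \<open>V\<close> and is orthogonal to
  \<open>V\<close>, hence to itself.\<close>

lemma proj_unique:
  assumes "v \<in> V" "\<And>w. w \<in> V \<Longrightarrow> (\<Sum>i\<in>I. inner (u i - v i) (w i)) = 0" "i \<in> I"
  shows "proj u i = v i"
proof -
  define w where "w = (\<lambda>i. proj u i + (-1) *\<^sub>C v i)"
  have w: "w \<in> V" unfolding w_def by (intro add_in scale_in proj_in assms(1))
  have "(\<Sum>i\<in>I. inner (w i) (w i)) = (\<Sum>i\<in>I. inner (u i - v i) (w i) - inner (u i - proj u i) (w i))"
    by (intro sum.cong refl) (simp add: w_def algebra_simps)
  also have "\<dots> = 0"
    by (simp add: sum_subtractf assms(2)[OF w] proj_orth[OF w])
  finally have "inner (w i) (w i) = 0"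
    using fin assms(3) by (subst (asm) sum_nonneg_eq_0_iff) auto
  then show ?thesis by (simp add: w_def)
qed

lemma proj_id: "v \<in> V \<Longrightarrow> i \<in> I \<Longrightarrow> proj v i = v i"
  by (rule proj_unique) auto

text \<open>The choice in \<open>proj\<close> sees \<open>u\<close> only through its values on
  \<open>I\<close>, so the two projections agree even off \<open>I\<close>.\<close>

lemma proj_cong: "(\<And>i. i \<in> I \<Longrightarrow> u i = v i) \<Longrightarrow> proj u = proj v"
  unfolding proj_def by (metis (mono_tags, lifting) sum.cong)

lemma proj_add: "i \<in> I \<Longrightarrow> proj (\<lambda>j. u j + v j) i = proj u i + proj v i"
proof (rule proj_unique[OF add_in[OF proj_in proj_in]])
  fix w assume w: "w \<in> V"
  show "(\<Sum>i\<in>I. inner (u i + v i - (proj u i + proj v i)) (w i)) = 0"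
    using proj_orth[OF w, of u] proj_orth[OF w, of v]
    by (simp add: add_diff_add inner_add_left sum.distrib)
qed

text \<open>Invariance of \<open>V\<close> under \<open>cadjoint A\<close> makes \<open>A\<close>
  preserve the orthogonal complement as well, so \<open>A\<close> respects the decomposition of
  \<open>u\<close>.\<close>

lemma proj_commute:
  assumes A: "A \<in> bounded_ops" and V: "\<And>v. v \<in> V \<Longrightarrow> A \<circ> v \<in> V" "\<And>v. v \<in> V \<Longrightarrow> cadjoint A \<circ> v \<in> V"
    and i: "i \<in> I"
  shows "proj (\<lambda>j. A (u j)) i = A (proj u i)"
proof (rule proj_unique[OF _ _ i])
  show "(\<lambda>i. A (proj u i)) \<in> V" using V(1)[OF proj_in] by (simp add: o_def)
  fix w assume w: "w \<in> V"
  have "(\<Sum>i\<in>I. inner (A (u i) - A (proj u i)) (w i)) = (\<Sum>i\<in>I. inner (u i - proj u i) ((cadjoint A \<circ> w) i))"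
    by (simp add: bounded_opsD(3)[OF A, symmetric] inner_cadjoint[OF A])
  then show "(\<Sum>i\<in>I. inner (A (u i) - A (proj u i)) (w i)) = 0"
    using proj_orth[OF V(2)[OF w]] by simp
qed

lemma proj_scaleC: "i \<in> I \<Longrightarrow> proj (\<lambda>j. c *\<^sub>C u j) i = c *\<^sub>C proj u i"
  by (rule proj_commute[OF bounded_ops_scaleC]) (auto simp: o_def cadjoint_scaleC intro: scale_in)

text \<open>\<open>w - proj w\<close> is orthogonal to \<open>V\<close>. The right-hand side is
  symmetric in \<open>u\<close> and \<open>w\<close>, so this contains the self-adjointness of the
  projection.\<close>

lemma proj_inner: "(\<Sum>i\<in>I. inner (proj u i) (w i)) = (\<Sum>i\<in>I. inner (proj u i) (proj w i))"
proof -
  have "(\<Sum>i\<in>I. inner (proj u i) (w i)) - (\<Sum>i\<in>I. inner (proj u i) (proj w i))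
      = (\<Sum>i\<in>I. inner (w i - proj w i) (proj u i))"
    unfolding sum_subtractf[symmetric]
    by (intro sum.cong refl) (simp add: inner_diff_left inner_diff_right inner_commute)
  then show ?thesis by (simp add: proj_orth[OF proj_in])
qed

lemma proj_norm: "(\<Sum>i\<in>I. (norm (proj u i))\<^sup>2) + (\<Sum>i\<in>I. (norm (u i - proj u i))\<^sup>2) = (\<Sum>i\<in>I. (norm (u i))\<^sup>2)"
proof -
  have "(norm (u i))\<^sup>2 = (norm (proj u i))\<^sup>2 + (norm (u i - proj u i))\<^sup>2 + 2 * inner (u i - proj u i) (proj u i)" for i
    by (simp add: power2_norm_eq_inner algebra_simps inner_commute)
  then show ?thesis
    by (simp add: sum.distrib proj_orth[OF proj_in] flip: sum_distrib_left)
qed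

definition single :: "'i \<Rightarrow> 'a \<Rightarrow> 'i \<Rightarrow> 'a" where
  "single j x = (\<lambda>k. if k = j then x else 0)"

definition entry :: "'i \<Rightarrow> 'i \<Rightarrow> 'a \<Rightarrow> 'a" where
  "entry i j x = proj (single j x) i"

lemma norm_single: "j \<in> I \<Longrightarrow> (\<Sum>i\<in>I. (norm (single j x i))\<^sup>2) = (norm x)\<^sup>2"
  by (subst sum.remove[OF fin, of j]) (auto simp: single_def)

lemma inner_single: "j \<in> I \<Longrightarrow> (\<Sum>i\<in>I. inner (v i) (single j x i)) = inner (v j) x"
  by (subst sum.remove[OF fin, of j]) (auto simp: single_def)

lemma entry_bounded_ops:
  assumes "i \<in> I" "j \<in> I"
  shows "entry i j \<in> bounded_ops"
proof (rule bounded_opsI[of _ 1])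
  have "single j (x + y) = (\<lambda>k. single j x k + single j y k)" for x y
    by (auto simp: single_def)
  then show "entry i j (x + y) = entry i j x + entry i j y" for x y
    by (simp add: entry_def proj_add assms)
  have "single j (c *\<^sub>C x) = (\<lambda>k. c *\<^sub>C single j x k)" for c x
    by (auto simp: single_def)
  then show "entry i j (c *\<^sub>C x) = c *\<^sub>C entry i j x" for c x
    by (simp add: entry_def proj_scaleC assms)
  show "norm (entry i j x) \<le> norm x * 1" for x
  proof -
    have "(norm (entry i j x))\<^sup>2 \<le> (\<Sum>i\<in>I. (norm (proj (single j x) i))\<^sup>2)"
      unfolding entry_def by (rule member_le_sum[OF assms(1)]) (auto simp: fin)
    also have "\<dots> \<le> (\<Sum>i\<in>I. (norm (single j x i))\<^sup>2)"
      using proj_norm[of "single j x"] sum_nonneg[of I "\<lambda>i. (norm (single j x i - proj (single j x) i))\<^sup>2"] by auto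
    finally show ?thesis
      by (simp add: norm_single assms power2_le_iff_abs_le)
  qed
qed

lemma proj_eq_sum_entry:
  assumes "i \<in> I"
  shows "proj u i = (\<Sum>j\<in>I. entry i j (u j))"
proof -
  \<comment> \<open>Cutting \<open>u\<close> off outside an arbitrary finite \<open>J\<close> allows
    an induction that adds one summand at a time.\<close>
  have "proj (\<lambda>k. if k \<in> J then u k else 0) i = (\<Sum>j\<in>J. entry i j (u j))" if "finite J" for J
    using that
  proof (induction J)
    case empty
    then show ?case using proj_id[OF zero_in assms] by simp
  next
    case (insert j J)
    have "(\<lambda>k. if k \<in> insert j J then u k else 0) = (\<lambda>k. single j (u j) k + (if k \<in> J then u k else 0))"
      using insert by (auto simp: single_def)
    then show ?case
      using insert proj_add[OF assms, of "single j (u j)" "\<lambda>k. if k \<in> J then u k else 0"] by (simp add: entry_def)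
  qed
  from this[OF fin] show ?thesis
    using proj_cong[of u "\<lambda>k. if k \<in> I then u k else 0"] by simp
qed

text \<open>Both sides equal the inner product of the projections of \<open>single j x\<close> and
  \<open>single i y\<close>.\<close>

lemma inner_entry:
  assumes "i \<in> I" "j \<in> I"
  shows "inner (entry i j x) y = inner x (entry j i y)"
proof -
  have "inner (entry i j x) y = (\<Sum>k\<in>I. inner (proj (single j x) k) (single i y k))"
    using assms by (simp add: inner_single entry_def)
  also have "\<dots> = (\<Sum>k\<in>I. inner (proj (single i y) k) (single j x k))"
    by (subst (1 2) proj_inner) (simp add: inner_commute)
  also have "\<dots> = inner (entry j i y) x"
    using assms by (simp add: inner_single entry_def)
  finally show ?thesis by (simp add: inner_commute)
qed

lemma cadjoint_entry: "i \<in> I \<Longrightarrow> j \<in> I \<Longrightarrow> cadjoint (entry i j) = entry j i"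
  by (intro cadjoint_eqI entry_bounded_ops inner_entry)

lemma entry_commute:
  assumes A: "A \<in> bounded_ops" and "\<And>v. v \<in> V \<Longrightarrow> A \<circ> v \<in> V" "\<And>v. v \<in> V \<Longrightarrow> cadjoint A \<circ> v \<in> V"
    and "i \<in> I" "j \<in> I"
  shows "A \<circ> entry i j = entry i j \<circ> A"
proof
  fix x
  have "single j (A x) = (\<lambda>k. A (single j x k))"
    by (auto simp: single_def bounded_opsD(5)[OF A])
  then show "(A \<circ> entry i j) x = (entry i j \<circ> A) x"
    using proj_commute[OF assms(1-4)] by (simp add: entry_def)
qed

text \<open>Both sides are the squared norm of the projection of \<open>single j x\<close>; in
  particular the diagonal entries are positive.\<close>

lemma inner_entry_self:
  assumes "j \<in> I"
  shows "inner (entry j j x) x = (\<Sum>i\<in>I. (norm (entry i j x))\<^sup>2)"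
  using inner_single[OF assms, of "proj (single j x)" x] proj_inner[of "single j x" "single j x"]
  by (simp add: entry_def power2_norm_eq_inner)

lemma sum_norm_entry_le: "j \<in> I \<Longrightarrow> (\<Sum>i\<in>I. (norm (entry i j x))\<^sup>2) \<le> (norm x)\<^sup>2"
  using proj_norm[of "single j x"] sum_nonneg[of I "\<lambda>i. (norm (single j x i - proj (single j x) i))\<^sup>2"]
  by (simp add: entry_def norm_single)

text \<open>\<open>x - entry j j x\<close> is one coordinate of \<open>single j x\<close> minus its
  projection. The contraction obtained here is the input of the square root construction.\<close>

lemma norm_diff_entry_le:
  assumes "j \<in> I"
  shows "norm (x - entry j j x) \<le> norm x"
proof -
  have "(norm (x - entry j j x))\<^sup>2 \<le> (\<Sum>i\<in>I. (norm (single j x i - proj (single j x) i))\<^sup>2)"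
    using member_le_sum[OF assms, of "\<lambda>i. (norm (single j x i - proj (single j x) i))\<^sup>2"] fin
    by (simp add: entry_def single_def)
  also have "\<dots> \<le> (norm x)\<^sup>2"
    using proj_norm[of "single j x"] sum_nonneg[of I "\<lambda>i. (norm (proj (single j x) i))\<^sup>2"]
    by (simp add: norm_single[OF assms])
  finally show ?thesis by (simp add: power2_le_iff_abs_le)
qed

end

section \<open>The double commutant theorem\<close>

lemma commutantD: "B \<in> commutant M \<Longrightarrow> A \<in> M \<Longrightarrow> A (B x) = B (A x)"
  by (metis (mono_tags, lifting) commutant_def comp_apply mem_Collect_eq)

text \<open>A basic neighbourhood restricts \<open>cinner (A x) y\<close> for finitely many pairs
  \<open>(x, y)\<close> only; \<open>S\<close> collects the first components of these pairs.\<close>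

lemma openin_weak_op_topology_pointwise_limit:
  assumes "openin weak_op_topology W" "A \<in> W"
  obtains S :: "'a::complex_hilbert set" where "finite S"
    "\<And>X. (\<And>n. X n \<in> bounded_ops) \<Longrightarrow> (\<And>x. x \<in> S \<Longrightarrow> (\<lambda>n. X n x) \<longlonglongrightarrow> A x) \<Longrightarrow> \<exists>n. X n \<in> W"
proof -
  define f where "f = (\<lambda>(A::'a \<Rightarrow> 'a) (x, y). cinner (A x) y)"
  obtain U where U: "open U" "W = f -` U \<inter> bounded_ops"
    using assms(1) unfolding weak_op_topology_def openin_pullback_topology f_def by auto
  have "openin (product_topology (\<lambda>_. euclidean) UNIV) U" "f A \<in> U"
    using U assms(2) by (auto simp: open_fun_def)
  from product_topology_open_contains_basis[OF this]
  obtain Z where Z: "f A \<in> Pi\<^sub>E UNIV Z" "\<And>p. openin euclidean (Z p)"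
    "finite {p. Z p \<noteq> topspace euclidean}" "Pi\<^sub>E UNIV Z \<subseteq> U" by metis
  define J where "J = {p. Z p \<noteq> UNIV}"
  have J: "finite J" using Z(3) by (simp add: J_def)
  show thesis
  proof (rule that[of "fst ` J"])
    fix X assume X: "\<And>n. X n \<in> bounded_ops" "\<And>x. x \<in> fst ` J \<Longrightarrow> (\<lambda>n. X n x) \<longlonglongrightarrow> A x"
    have "\<forall>\<^sub>F n in sequentially. f (X n) p \<in> Z p" if "p \<in> J" for p
    proof (rule topological_tendstoD)
      obtain x y where p: "p = (x, y)" by force
      have x: "(\<lambda>n. X n x) \<longlonglongrightarrow> A x" using X(2) that p by force
      \<comment> \<open>Writing \<open>cinner\<close> through real inner products reduces its
        continuity to theirs.\<close>
      have *: "cinner a y = Complex (inner a y) (- inner (\<i> *\<^sub>C a) y)" for a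
        by (rule complex_eqI) (simp_all add: Re_cinner inner_i_left)
      show "(\<lambda>n. f (X n) p) \<longlonglongrightarrow> f A p"
        unfolding p f_def prod.case *
        by (intro tendsto_intros x bounded_linear.tendsto[OF bounded_linear_scaleC])
      show "open (Z p)" using Z(2)[of p] by (simp only: open_openin)
      show "f A p \<in> Z p" using Z(1) by blast
    qed
    then have "\<forall>\<^sub>F n in sequentially. \<forall>p\<in>J. f (X n) p \<in> Z p"
      using J by (simp add: eventually_ball_finite)
    then obtain n where n: "\<And>p. p \<in> J \<Longrightarrow> f (X n) p \<in> Z p"
      by (auto dest!: eventually_happens'[OF sequentially_bot])
    have "f (X n) p \<in> Z p" for p
      using n[of p] by (cases "p \<in> J") (auto simp: J_def)
    then have "f (X n) \<in> U" using Z(4) by (auto simp: PiE_UNIV_domain)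
    then show "\<exists>n. X n \<in> W" using U X(1) by auto
  qed (use J in simp)
qed

text \<open>
  The entries of the projection onto the closure \<open>V\<close> of the orbit of \<open>S\<close> under \<open>M\<close>, a subspace of the sum
  of copies of \<open>'a\<close> indexed by \<open>S\<close>, lie in the commutant of \<open>M\<close>. So they commute with \<open>A\<close>, and \<open>A\<close>
  preserves \<open>V\<close>, which contains the identical family.
\<close>

lemma double_commutant_finite_approx:
  fixes M :: "('a::complex_hilbert \<Rightarrow> 'a) set"
  assumes M: "von_neumann_algebra M" and A: "A \<in> commutant (commutant M)" and "finite S"
  obtains X where "\<And>n. X n \<in> M" "\<And>x. x \<in> S \<Longrightarrow> (\<lambda>n. X n x) \<longlonglongrightarrow> A x"
proof -
  have MB: "M \<subseteq> bounded_ops" using M by (simp add: von_neumann_algebra_def)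
  \<comment> \<open>The closure of the orbit, by approximation uniform over the finite set
    \<open>S\<close>; \<open>VI\<close> and \<open>VE\<close> translate it to sequences and
    back.\<close>
  define V where "V = {v. \<forall>e>0. \<exists>B\<in>M. \<forall>x\<in>S. dist (B x) (v x) < e}"
  have VI: "v \<in> V" if "\<And>n. X n \<in> M" "\<And>x. x \<in> S \<Longrightarrow> (\<lambda>n. X n x) \<longlonglongrightarrow> v x" for v X
  proof -
    have "\<exists>n. \<forall>x\<in>S. dist (X n x) (v x) < e" if "e > 0" for e
    proof -
      have "\<forall>\<^sub>F n in sequentially. \<forall>x\<in>S. dist (X n x) (v x) < e"
        by (intro eventually_ball_finite \<open>finite S\<close> ballI tendstoD[OF _ \<open>e > 0\<close>]) fact
      then show ?thesis by (auto dest!: eventually_happens'[OF sequentially_bot])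
    qed
    then show ?thesis using \<open>\<And>n. X n \<in> M\<close> unfolding V_def by blast
  qed
  have VE: "\<exists>X. (\<forall>n. X n \<in> M) \<and> (\<forall>x\<in>S. (\<lambda>n. X n x) \<longlonglongrightarrow> v x)" if "v \<in> V" for v
  proof -
    have "\<exists>B\<in>M. \<forall>x\<in>S. dist (B x) (v x) < inverse (Suc n)" for n
      using that by (simp add: V_def)
    then obtain X where X: "\<And>n. X n \<in> M" "\<And>n x. x \<in> S \<Longrightarrow> dist (X n x) (v x) < inverse (Suc n)"
      by metis
    have "(\<lambda>n. X n x) \<longlonglongrightarrow> v x" if "x \<in> S" for x
      by (rule metric_tendsto_imp_tendsto[OF LIMSEQ_inverse_real_of_nat])
        (use X(2)[OF that] in \<open>auto intro!: always_eventually less_imp_le simp: dist_real_def\<close>)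
    with X(1) show ?thesis by blast
  qed
  have inv: "B \<circ> v \<in> V" if B: "B \<in> M" and v: "v \<in> V" for B v
  proof -
    obtain X where X: "\<forall>n. X n \<in> M" "\<forall>x\<in>S. (\<lambda>n. X n x) \<longlonglongrightarrow> v x" using VE[OF v] by blast
    have "bounded_linear B" using B MB bounded_opsD(1) by blast
    then show ?thesis
      using X B M
      by (intro VI[of "\<lambda>n. B \<circ> X n"]) (auto simp: von_neumann_algebra_def intro: bounded_linear.tendsto)
  qed
  interpret closed_subspace_of_sum S V
  proof
    show "finite S" by fact
    have "(\<lambda>x. 0 *\<^sub>C id x) \<in> M" using M unfolding von_neumann_algebra_def by blast
    then show "(\<lambda>_. 0) \<in> V" by (intro VI[of "\<lambda>_ _. 0"]) auto
    show "(\<lambda>i. v i + w i) \<in> V" if v: "v \<in> V" and w: "w \<in> V" for v w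
    proof -
      obtain X where X: "\<forall>n. X n \<in> M" "\<forall>x\<in>S. (\<lambda>n. X n x) \<longlonglongrightarrow> v x" using VE[OF v] by blast
      obtain Y where Y: "\<forall>n. Y n \<in> M" "\<forall>x\<in>S. (\<lambda>n. Y n x) \<longlonglongrightarrow> w x" using VE[OF w] by blast
      show ?thesis
        using X Y M
        by (intro VI[of "\<lambda>n x. X n x + Y n x"]) (auto simp: von_neumann_algebra_def intro: tendsto_add)
    qed
    show "(\<lambda>i. c *\<^sub>C v i) \<in> V" if v: "v \<in> V" for c v
    proof -
      obtain X where X: "\<forall>n. X n \<in> M" "\<forall>x\<in>S. (\<lambda>n. X n x) \<longlonglongrightarrow> v x" using VE[OF v] by blast
      then show ?thesis
        using M
        by (intro VI[of "\<lambda>n x. c *\<^sub>C X n x"])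
          (auto simp: von_neumann_algebra_def intro: bounded_linear.tendsto[OF bounded_linear_scaleC])
    qed
    show "v \<in> V" if X: "\<And>n. X n \<in> V" "\<And>i. i \<in> S \<Longrightarrow> (\<lambda>n. X n i) \<longlonglongrightarrow> v i" for X v
      unfolding V_def
    proof (intro CollectI allI impI)
      fix e :: real assume "e > 0"
      have "\<forall>\<^sub>F n in sequentially. \<forall>x\<in>S. dist (X n x) (v x) < e/2"
        by (intro eventually_ball_finite \<open>finite S\<close> ballI tendstoD[OF X(2)]) (use \<open>e > 0\<close> in auto)
      then obtain n where n: "\<And>x. x \<in> S \<Longrightarrow> dist (X n x) (v x) < e/2"
        by (auto dest!: eventually_happens'[OF sequentially_bot])
      obtain B where "B \<in> M" "\<And>x. x \<in> S \<Longrightarrow> dist (B x) (X n x) < e/2"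
        using X(1)[of n] half_gt_zero[OF \<open>e > 0\<close>] unfolding V_def by blast
      then show "\<exists>B\<in>M. \<forall>x\<in>S. dist (B x) (v x) < e"
        using n by (meson dist_commute_lessI dist_triangle_half_r)
    qed
  qed
  have "B \<circ> entry i j = entry i j \<circ> B" if "B \<in> M" "i \<in> S" "j \<in> S" for B i j
    using that M MB by (intro entry_commute inv) (auto simp: von_neumann_algebra_def)
  then have "entry i j \<in> commutant M" if "i \<in> S" "j \<in> S" for i j
    using that by (simp add: commutant_def entry_bounded_ops)
  then have comm: "entry i j (A x) = A (entry i j x)" if "i \<in> S" "j \<in> S" for i j x
    using commutantD[OF A] that by blast
  have "id \<in> V" using M by (intro VI[of "\<lambda>_. id"]) (auto simp: von_neumann_algebra_def)
  have "bounded_linear A" using A by (simp add: commutant_def bounded_ops_def)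
  then interpret A: bounded_linear A .
  \<comment> \<open>The family \<open>A\<close> is \<open>A\<close> applied coordinatewise to the
    family \<open>id\<close> in \<open>V\<close>. Since \<open>A\<close> commutes with the entries,
    projecting the family \<open>A\<close> amounts to applying \<open>A\<close> to
    \<open>proj id\<close>.\<close>
  have "proj A x = A x" if "x \<in> S" for x
  proof -
    have "proj A x = (\<Sum>y\<in>S. A (entry x y y))"
      using that by (simp add: proj_eq_sum_entry comm)
    also have "\<dots> = A (proj id x)"
      using that by (simp add: proj_eq_sum_entry A.sum)
    finally show ?thesis using proj_id[OF \<open>id \<in> V\<close> that] by simp
  qed
  moreover obtain X where "\<forall>n. X n \<in> M" "\<forall>x\<in>S. (\<lambda>n. X n x) \<longlonglongrightarrow> proj A x"
    using VE[OF proj_in[of A]] by blast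
  ultimately show thesis by (intro that[of X]) auto
qed

text \<open>If \<open>A\<close> were outside \<open>M\<close>, the complement of the weakly closed
  \<open>M\<close> would be a neighbourhood of \<open>A\<close>, yet it would contain one of the
  elements of \<open>M\<close> approximating \<open>A\<close> on a finite set.\<close>

lemma commutant_commutant_subset:
  fixes M :: "('a::complex_hilbert \<Rightarrow> 'a) set"
  assumes M: "von_neumann_algebra M"
  shows "commutant (commutant M) \<subseteq> M"
proof (rule subsetI, rule ccontr)
  fix A assume A: "A \<in> commutant (commutant M)" "A \<notin> M"
  have M_sub: "M \<subseteq> bounded_ops" using M by (simp add: von_neumann_algebra_def)
  have "closedin weak_op_topology M" using M by (simp add: von_neumann_algebra_def)
  moreover have "topspace (weak_op_topology :: ('a \<Rightarrow> 'a) topology) = bounded_ops"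
    unfolding weak_op_topology_def topspace_pullback_topology by simp
  ultimately have "openin weak_op_topology (bounded_ops - M)"
    by (simp add: closedin_def)
  moreover have "A \<in> bounded_ops - M" using A by (simp add: commutant_def)
  ultimately obtain S where S: "finite S"
    "\<And>X. (\<And>n. X n \<in> bounded_ops) \<Longrightarrow> (\<And>x. x \<in> S \<Longrightarrow> (\<lambda>n. X n x) \<longlonglongrightarrow> A x) \<Longrightarrow> \<exists>n. X n \<in> bounded_ops - M"
    using openin_weak_op_topology_pointwise_limit by blast
  obtain X where "\<And>n. X n \<in> M" "\<And>x. x \<in> S \<Longrightarrow> (\<lambda>n. X n x) \<longlonglongrightarrow> A x"
    using double_commutant_finite_approx[OF M A(1) S(1)] by blast
  with S(2)[of X] M_sub show False by blast
qed

section \<open>Criteria for unitary and positive operators, and adjoints in the commutant\<close>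

lemma unitary_opI:
  assumes U: "U \<in> bounded_ops" and "\<And>x y. inner (U x) (U y) = inner x y" "surj U"
  shows "unitary_op U"
proof -
  have *: "cadjoint U (U x) = x" for x
    by (subst vector_eq_ldot[symmetric]) (simp add: inner_cadjoint[OF U, symmetric] assms(2))
  have "U (cadjoint U y) = y" for y
    using * surjD[OF assms(3), of y] by metis
  with * show ?thesis using U by (auto simp: unitary_op_def fun_eq_iff)
qed

lemma unitary_opD:
  assumes "unitary_op U"
  shows "U \<in> bounded_ops" "cadjoint U (U x) = x" "U (cadjoint U x) = x"
  using assms by (auto simp: unitary_op_def fun_eq_iff)

lemma unitary_op_cadjoint: "unitary_op U \<Longrightarrow> unitary_op (cadjoint U)"
  by (simp add: unitary_op_def cadjoint_bounded_ops cadjoint_cadjoint)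

text \<open>Symmetry makes \<open>cinner (P x) x\<close> equal to its conjugate, so its real part
  decides.\<close>

lemma positive_opI:
  assumes P: "P \<in> bounded_ops" and sym: "\<And>x y. inner (P x) y = inner x (P y)" and pos: "\<And>x. 0 \<le> inner (P x) x"
  shows "positive_op P"
  unfolding positive_op_def
proof (intro conjI P allI)
  fix x
  have "cinner (P x) x = cnj (cinner (P x) x)"
    using cinner_adjoint_if_inner_adjoint[OF P sym, of x x] cinner_commute by metis
  then have "Im (cinner (P x) x) = - Im (cinner (P x) x)"
    by (metis complex_cnj_cancel_iff cnj.sel(2))
  then show "cinner (P x) x \<in> \<real>\<^sub>\<ge>\<^sub>0"
    using pos[of x] by (simp add: complex_nonneg_Reals_iff Re_cinner)
qed

text \<open>Take adjoints in the relation that \<open>C\<close> commutes with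
  \<open>cadjoint A\<close>.\<close>

lemma commutant_cadjoint:
  assumes "M \<subseteq> bounded_ops" "\<And>A. A \<in> M \<Longrightarrow> cadjoint A \<in> M" and C: "C \<in> commutant M"
  shows "cadjoint C \<in> commutant M"
proof -
  have CB: "C \<in> bounded_ops" using C by (simp add: commutant_def)
  have "A (cadjoint C y) = cadjoint C (A y)" if A: "A \<in> M" for A y
  proof (subst vector_eq_ldot[symmetric], rule allI)
    fix x
    have AB: "A \<in> bounded_ops" using A assms(1) by blast
    have "inner x (A (cadjoint C y)) = inner (C (cadjoint A x)) y"
      by (simp add: inner_cadjoint[OF CB] inner_cadjoint'[OF AB])
    also have "\<dots> = inner (cadjoint A (C x)) y"
      using commutantD[OF C assms(2)[OF A]] by simp
    also have "\<dots> = inner x (cadjoint C (A y))"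
      by (simp add: inner_cadjoint[OF CB] inner_cadjoint'[OF AB])
    finally show "inner x (A (cadjoint C y)) = inner x (cadjoint C (A y))" .
  qed
  then show ?thesis
    by (auto simp: commutant_def cadjoint_bounded_ops[OF CB] fun_eq_iff)
qed

section \<open>The Cayley transform\<close>

text \<open>The cross terms cancel because \<open>A\<close> is symmetric and multiplication by
  \<open>c\<close> is skew. So \<open>A + c\<close> is bounded below by 1, which gives injectivity
  and closed range; the range is dense because the adjoint \<open>A - c\<close> is bounded below
  too.\<close>

lemma selfadjoint_plus_imaginary:
  fixes A :: "'a::complex_hilbert \<Rightarrow> 'a"
  assumes A: "A \<in> bounded_ops" "cadjoint A = A" and c: "c = \<i> \<or> c = - \<i>"
  shows "inner (A x + c *\<^sub>C x) (A y + c *\<^sub>C y) = inner (A x) (A y) + inner x y"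
    and "inj (\<lambda>x. A x + c *\<^sub>C x)" "surj (\<lambda>x. A x + c *\<^sub>C x)"
proof -
  note sym = inner_cadjoint[OF A(1), unfolded A(2)]
  have cc: "cnj c = - c" "c * c = -1" using c by auto
  \<comment> \<open>Kept general in \<open>d\<close>, since it is needed for \<open>c\<close> and
    for \<open>- c\<close>.\<close>
  have ip: "inner (A x + d *\<^sub>C x) (A y + d *\<^sub>C y) = inner (A x) (A y) + inner x y"
    if "cnj d = - d" "d * d = -1" for d x y
  proof -
    have "inner (A x) (d *\<^sub>C y) = - inner (d *\<^sub>C x) (A y)"
      by (simp add: sym bounded_opsD(7)[OF A(1)] inner_scaleC_left that)
    moreover have "inner (d *\<^sub>C x) (d *\<^sub>C y) = inner x y"
      by (simp add: inner_scaleC_left scaleC_scaleC that)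
    ultimately show ?thesis by (simp add: inner_add_left inner_add_right)
  qed
  show "inner (A x + c *\<^sub>C x) (A y + c *\<^sub>C y) = inner (A x) (A y) + inner x y" for x y
    by (rule ip[OF cc])
  have bound: "norm x \<le> norm (A x + d *\<^sub>C x)" if "cnj d = - d" "d * d = -1" for d x
    by (rule power2_le_imp_le) (simp_all add: power2_norm_eq_inner ip[OF that])
  define R where "R = (\<lambda>x. A x + c *\<^sub>C x)"
  have R: "R \<in> bounded_ops"
    unfolding R_def by (intro bounded_ops_add A(1) bounded_ops_scaleC)
  have R_bound: "norm x \<le> norm (R x)" for x unfolding R_def by (rule bound[OF cc])
  show "inj R"
  proof (rule injI)
    fix x y assume "R x = R y"
    then show "x = y" using R_bound[of "x - y"] by (simp add: bounded_opsD(3)[OF R])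
  qed
  have "closure (range R) = UNIV"
  proof (rule closure_UNIV_if_orthogonal_zero)
    show "subspace (range R)"
      by (rule linear_subspace_image[OF bounded_linear.linear[OF bounded_opsD(1)[OF R]] subspace_UNIV])
    fix x assume *: "\<And>w. w \<in> range R \<Longrightarrow> inner x w = 0"
    \<comment> \<open>A vector orthogonal to the range of \<open>R\<close> is in the kernel of the
      adjoint \<open>A - c\<close>.\<close>
    have "inner (A x + (- c) *\<^sub>C x) w = inner x (R w)" for w
      by (simp add: R_def inner_add_left inner_add_right sym inner_diff_left inner_scaleC_left cc)
    then have "A x + (- c) *\<^sub>C x = 0"
      using * by (metis inner_eq_zero_iff rangeI)
    with bound[of "- c" x] cc show "x = 0" by simp
  qed
  moreover have "closed (range R)"
    unfolding closed_sequential_limits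
  proof (intro allI impI)
    fix w l assume *: "(\<forall>n. w n \<in> range R) \<and> w \<longlonglongrightarrow> l"
    then have "\<forall>n. \<exists>z. w n = R z" by blast
    then obtain z where z: "\<And>n. w n = R (z n)" by metis
    have "Cauchy z"
    proof (rule metric_CauchyI)
      fix e :: real assume "e > 0"
      have "Cauchy w" using * LIMSEQ_imp_Cauchy by blast
      then obtain N where "\<forall>m\<ge>N. \<forall>n\<ge>N. dist (w m) (w n) < e" using \<open>e > 0\<close> by (meson metric_CauchyD)
      moreover have "dist (z m) (z n) \<le> dist (w m) (w n)" for m n
        using R_bound[of "z m - z n"] by (simp add: dist_norm z bounded_opsD(3)[OF R])
      ultimately show "\<exists>N. \<forall>m\<ge>N. \<forall>n\<ge>N. dist (z m) (z n) < e"
        using le_less_trans by blast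
    qed
    then obtain k where "z \<longlonglongrightarrow> k" by (auto simp: Cauchy_convergent_iff convergent_def)
    then have "w \<longlonglongrightarrow> R k"
      unfolding z by (rule bounded_linear.tendsto[OF bounded_opsD(1)[OF R]])
    then show "l \<in> range R" using * LIMSEQ_unique by blast
  qed
  ultimately show "surj R" by simp
qed

text \<open>\<open>R = A + \<i>\<close> and \<open>S = A - \<i>\<close> are bijections that
  transform the inner product in the same way, so \<open>S\<close> after the inverse of
  \<open>R\<close> is unitary.\<close>

lemma cayley_transform:
  fixes A :: "'a::complex_hilbert \<Rightarrow> 'a"
  assumes A: "A \<in> bounded_ops" "cadjoint A = A"
  obtains U where "unitary_op U" "\<And>x. U (A x + \<i> *\<^sub>C x) = A x - \<i> *\<^sub>C x"
proof -
  define R where "R = (\<lambda>x. A x + \<i> *\<^sub>C x)"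
  define S where "S = (\<lambda>x. A x + (- \<i>) *\<^sub>C x)"
  have RS: "R \<in> bounded_ops" "S \<in> bounded_ops"
    unfolding R_def S_def by (intro bounded_ops_add A(1) bounded_ops_scaleC)+
  have R: "inner (R x) (R y) = inner (A x) (A y) + inner x y" "inj R" "surj R" for x y
    unfolding R_def using selfadjoint_plus_imaginary[OF A, of \<i>] by simp_all
  have S: "inner (S x) (S y) = inner (A x) (A y) + inner x y" "surj S" for x y
    unfolding S_def using selfadjoint_plus_imaginary[OF A, of "- \<i>"] by simp_all
  define U where "U = S \<circ> inv R"
  have UR: "U (R x) = S x" for x by (simp add: U_def R(2))
  have ex: "\<exists>x. y = R x" for y using R(3) by (rule surjD)
  have ip: "inner (U x) (U y) = inner x y" for x y
    using ex[of x] ex[of y] by (auto simp: UR R S)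
  have "U \<in> bounded_ops"
  proof (rule bounded_opsI[of _ 1])
    show "U (x + y) = U x + U y" for x y
      using ex[of x] ex[of y] by (auto simp: UR bounded_opsD(2)[OF RS(2)] simp flip: bounded_opsD(2)[OF RS(1)])
    show "U (c *\<^sub>C x) = c *\<^sub>C U x" for c x
      using ex[of x] by (auto simp: UR bounded_opsD(7)[OF RS(2)] simp flip: bounded_opsD(7)[OF RS(1)])
    show "norm (U x) \<le> norm x * 1" for x
      by (simp add: norm_eq_sqrt_inner ip)
  qed
  moreover have "surj U" unfolding surj_def using UR S(2) by (metis surjD)
  ultimately have "unitary_op U" using ip by (intro unitary_opI)
  then show thesis using UR by (intro that) (auto simp: R_def S_def)
qed

text \<open>A self-adjoint element of the commutant can be recovered from its Cayley transform,
  which is a unitary of the commutant. A general element is a combination of two self-adjoint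
  ones.\<close>

lemma commute_commutant_if_commute_unitaries:
  fixes M :: "('a::complex_hilbert \<Rightarrow> 'a) set"
  assumes M: "M \<subseteq> bounded_ops" "\<And>A. A \<in> M \<Longrightarrow> cadjoint A \<in> M"
    and X: "X \<in> bounded_ops" "\<And>U x. U \<in> commutant M \<Longrightarrow> unitary_op U \<Longrightarrow> X (U x) = U (X x)"
    and C: "C \<in> commutant M"
  shows "X (C x) = C (X x)"
proof -
  have sa: "X (A x) = A (X x)" if A: "A \<in> commutant M" "cadjoint A = A" for A x
  proof -
    have AB: "A \<in> bounded_ops" using A(1) by (simp add: commutant_def)
    define R where "R = (\<lambda>x. A x + \<i> *\<^sub>C x)"
    obtain U where U: "unitary_op U" "\<And>x. U (R x) = A x - \<i> *\<^sub>C x"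
      using cayley_transform[OF AB A(2)] unfolding R_def by blast
    have R: "surj R" "inj R"
      unfolding R_def using selfadjoint_plus_imaginary[OF AB A(2), of \<i>] by simp_all
    note UB = unitary_opD(1)[OF U(1)]
    have "D (U y) = U (D y)" if D: "D \<in> M" for D y
    proof -
      have DB: "D \<in> bounded_ops" using D M(1) by blast
      obtain x where x: "y = R x" using surjD[OF R(1)] by blast
      have "D (R x) = R (D x)"
        by (simp add: R_def bounded_opsD(2,7)[OF DB] commutantD[OF A(1) D])
      then show ?thesis
        by (simp add: x U(2) bounded_opsD(3,7)[OF DB] commutantD[OF A(1) D])
    qed
    then have "U \<in> commutant M" using UB by (auto simp: commutant_def)
    then have XU: "X (U y) = U (X y)" for y using X(2) U(1) by blast
    \<comment> \<open>Evaluating \<open>XU\<close> at \<open>R x\<close> shows that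
      \<open>X (A x)\<close> and \<open>X x\<close> satisfy the same two equations, with signs plus
      and minus, as \<open>A z\<close> and \<open>z\<close>. Subtracting them gives
      \<open>X x = z\<close>, and then \<open>X (A x) = A z\<close>.\<close>
    obtain z where z: "X (R x) = R z" using surjD[OF R(1)] by blast
    have "X (A x - \<i> *\<^sub>C x) = A z - \<i> *\<^sub>C z"
      using XU[of "R x"] by (simp add: U(2) z)
    then have 1: "X (A x) - \<i> *\<^sub>C X x = A z - \<i> *\<^sub>C z"
      by (simp add: bounded_opsD(3,7)[OF X(1)])
    have 2: "X (A x) + \<i> *\<^sub>C X x = A z + \<i> *\<^sub>C z"
      using z by (simp add: R_def bounded_opsD(2,7)[OF X(1)])
    have "(X (A x) + \<i> *\<^sub>C X x) - (X (A x) - \<i> *\<^sub>C X x) = (A z + \<i> *\<^sub>C z) - (A z - \<i> *\<^sub>C z)"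
      by (simp only: 1 2)
    then have "2 *\<^sub>R (\<i> *\<^sub>C X x) = 2 *\<^sub>R (\<i> *\<^sub>C z)"
      by (simp add: scaleR_2)
    then have "(- \<i>) *\<^sub>C \<i> *\<^sub>C X x = (- \<i>) *\<^sub>C \<i> *\<^sub>C z" by simp
    then have "X x = z" unfolding scaleC_scaleC by simp
    with 2 show ?thesis by simp
  qed
  have CB: "C \<in> bounded_ops" "cadjoint C \<in> bounded_ops"
    using C by (simp_all add: commutant_def cadjoint_bounded_ops)
  note C' = commutant_cadjoint[OF M C]
  \<comment> \<open>Twice the real part and minus twice the imaginary part of \<open>C\<close>: both
    are self-adjoint, and \<open>A1 - \<i> A2 = 2 C\<close>.\<close>
  define A1 where "A1 = (\<lambda>x. C x + cadjoint C x)"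
  define A2 where "A2 = (\<lambda>x. \<i> *\<^sub>C (C x - cadjoint C x))"
  have A1B: "A1 \<in> bounded_ops" and A2B: "A2 \<in> bounded_ops"
    using bounded_ops_add[OF CB] bounded_ops_comp[OF bounded_ops_scaleC bounded_ops_diff[OF CB], of \<i>]
    by (simp_all add: A1_def A2_def o_def)
  have "D (A1 x) = A1 (D x)" "D (A2 x) = A2 (D x)" if "D \<in> M" for D x
  proof -
    have "D \<in> bounded_ops" using that M(1) by blast
    then show "D (A1 x) = A1 (D x)" "D (A2 x) = A2 (D x)"
      by (simp_all add: A1_def A2_def bounded_opsD(2,3,7) commutantD[OF C that] commutantD[OF C' that])
  qed
  then have A: "A1 \<in> commutant M" "A2 \<in> commutant M"
    using A1B A2B by (auto simp: commutant_def)
  have "cadjoint A1 = A1"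
    by (rule cadjoint_eqI[OF A1B])
      (simp add: A1_def inner_add_left inner_add_right inner_cadjoint[OF CB(1)] inner_cadjoint'[OF CB(1)])
  moreover have "cadjoint A2 = A2"
    by (rule cadjoint_eqI[OF A2B])
      (simp add: A2_def inner_scaleC_left inner_diff_left inner_diff_right inner_cadjoint[OF CB(1)]
        inner_cadjoint'[OF CB(1)] scaleC_diff_right bounded_opsD(7)[OF CB(1)] bounded_opsD(7)[OF CB(2)]
        bounded_opsD(4)[OF CB(1)] bounded_opsD(4)[OF CB(2)])
  ultimately have XA: "X (A1 x) = A1 (X x)" "X (A2 x) = A2 (X x)" for x
    using sa A by blast+
  have C_eq: "A1 x + (- \<i>) *\<^sub>C A2 x = 2 *\<^sub>R C x" for x
    unfolding A1_def A2_def scaleC_scaleC by (simp add: scaleR_2)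
  have "2 *\<^sub>R X (C x) = X (A1 x + (- \<i>) *\<^sub>C A2 x)"
    by (simp only: C_eq bounded_opsD(6)[OF X(1)])
  also have "\<dots> = A1 (X x) + (- \<i>) *\<^sub>C A2 (X x)"
    by (simp only: bounded_opsD(2,7)[OF X(1)] XA)
  also have "\<dots> = 2 *\<^sub>R C (X x)" by (rule C_eq)
  finally show ?thesis by simp
qed

text \<open>Such an \<open>X\<close> commutes with the whole commutant and so lies in the double
  commutant. Every operator built from \<open>T\<close> is placed in \<open>M\<close> in this
  way.\<close>

lemma in_von_neumann_algebra_if_commute_unitaries:
  assumes M: "von_neumann_algebra M" and X: "X \<in> bounded_ops"
    and "\<And>U x. U \<in> commutant M \<Longrightarrow> unitary_op U \<Longrightarrow> X (U x) = U (X x)"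
  shows "X \<in> M"
proof -
  have "X (C x) = C (X x)" if "C \<in> commutant M" for C x
    by (rule commute_commutant_if_commute_unitaries[OF _ _ X assms(3) that])
      (use M in \<open>simp_all add: von_neumann_algebra_def\<close>)
  then have "X \<in> commutant (commutant M)"
    using X unfolding commutant_def[of "commutant M"] by (auto simp: fun_eq_iff)
  with commutant_commutant_subset[OF M] show ?thesis by blast
qed

section \<open>Square roots\<close>

text \<open>
  The square root of \<open>1 - X\<close> is \<open>1 - Z\<close>, where \<open>Z = (X + Z\<^sup>2) / 2\<close> is the limit of the iteration
  \<open>Y\<close>. Norms are controlled by the scalar iteration \<open>y\<close>, that is, the case \<open>X = 1\<close>.
\<close>

lemma sqrt_one_minus_contraction:
  fixes X :: "'a::complex_hilbert \<Rightarrow> 'a"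
  assumes X: "X \<in> bounded_ops" and contr: "\<And>x. norm (X x) \<le> norm x"
    and sym: "\<And>x y. inner (X x) y = inner x (X y)"
  obtains B where "B \<in> bounded_ops" "\<And>x y. inner (B x) y = inner x (B y)"
    "\<And>x. B (B x) = x - X x"
    "\<And>D x. D \<in> bounded_ops \<Longrightarrow> (\<And>x. D (X x) = X (D x)) \<Longrightarrow> D (B x) = B (D x)"
proof -
  define Y :: "nat \<Rightarrow> 'a \<Rightarrow> 'a" where
    "Y = rec_nat (\<lambda>x. 0) (\<lambda>_ Z x. (1/2) *\<^sub>R (X x + Z (Z x)))"
  define y :: "nat \<Rightarrow> real" where "y = rec_nat 0 (\<lambda>_ z. (1 + z\<^sup>2) / 2)"
  have Y_0: "Y 0 = (\<lambda>x. 0)" and Y_Suc: "Y (Suc n) = (\<lambda>x. (1/2) *\<^sub>R (X x + Y n (Y n x)))" for n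
    by (simp_all add: Y_def)
  have y_0: "y 0 = 0" and y_Suc: "y (Suc n) = (1 + (y n)\<^sup>2) / 2" for n
    by (simp_all add: y_def)
  have y_bounds: "0 \<le> y n \<and> y n \<le> 1" for n
    by (induction n) (auto simp: y_0 y_Suc power_le_one)
  have YB: "Y n \<in> bounded_ops" for n
  proof (induction n)
    case 0
    show ?case unfolding Y_0 by (rule bounded_opsI[of _ 0]) auto
  next
    case (Suc n)
    have "(\<lambda>x. complex_of_real (1/2) *\<^sub>C (X x + Y n (Y n x))) \<in> bounded_ops"
      using bounded_ops_comp[OF bounded_ops_scaleC bounded_ops_add[OF X bounded_ops_comp[OF Suc Suc]]]
      by (simp add: o_def)
    then show ?case unfolding Y_Suc scaleC_of_real .
  qed
  have Y_comm: "D (Y n x) = Y n (D x)" if "D \<in> bounded_ops" "\<And>x. D (X x) = X (D x)" for D n x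
    by (induction n arbitrary: x) (simp_all add: Y_0 Y_Suc bounded_opsD(2,5,6)[OF that(1)] that(2))
  have YY: "Y m (Y n x) = Y n (Y m x)" for m n x
    by (rule Y_comm[OF YB]) (simp add: Y_comm[OF X])
  have Y_sym: "inner (Y n x) z = inner x (Y n z)" for n x z
    by (induction n arbitrary: x z) (simp_all add: Y_0 Y_Suc inner_add_left inner_add_right sym)
  have Y_norm: "norm (Y n x) \<le> y n * norm x" for n x
  proof (induction n arbitrary: x)
    case (Suc n)
    have "norm (Y n (Y n x)) \<le> y n * (y n * norm x)"
      using Suc[of "Y n x"] Suc[of x] y_bounds[of n] by (meson mult_left_mono order_trans)
    then have "norm (X x + Y n (Y n x)) \<le> (1 + (y n)\<^sup>2) * norm x"
      using norm_triangle_ineq[of "X x" "Y n (Y n x)"] contr[of x] by (simp add: algebra_simps power2_eq_square)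
    then show ?case by (simp add: Y_Suc y_Suc)
  qed (simp add: Y_0 y_0)
  \<comment> \<open>The increments of \<open>Y\<close> are dominated by those of \<open>y\<close>,
    so the convergence of the bounded increasing sequence \<open>y\<close> carries over to
    \<open>Y\<close>.\<close>
  have step: "norm (Y (Suc n) x - Y n x) \<le> (y (Suc n) - y n) * norm x" for n x
  proof (induction n)
    case 0
    show ?case using contr[of x] by (simp add: Y_0 Y_Suc y_0 y_Suc)
  next
    case (Suc n)
    define a where "a = Y (Suc n) x - Y n x"
    have "Y (Suc (Suc n)) x - Y (Suc n) x = (1/2) *\<^sub>R (Y (Suc n) (Y (Suc n) x) - Y n (Y n x))"
      unfolding Y_Suc[of "Suc n"] by (subst (3) Y_Suc) (simp add: algebra_simps)
    \<comment> \<open>The iterates commute, so the difference of their squares factors.\<close>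
    also have "\<dots> = (1/2) *\<^sub>R (Y (Suc n) a + Y n a)"
      by (simp add: a_def bounded_opsD(3)[OF YB] YY[of n "Suc n"])
    finally have "norm (Y (Suc (Suc n)) x - Y (Suc n) x) = norm (Y (Suc n) a + Y n a) / 2"
      by simp
    also have "\<dots> \<le> (y (Suc n) * norm a + y n * norm a) / 2"
      using norm_triangle_ineq[of "Y (Suc n) a" "Y n a"] Y_norm[of "Suc n" a] Y_norm[of n a] by simp
    also have "\<dots> = (y (Suc n) + y n) / 2 * norm a" by (simp add: algebra_simps)
    also have "\<dots> \<le> (y (Suc n) + y n) / 2 * ((y (Suc n) - y n) * norm x)"
      using Suc y_bounds[of n] y_bounds[of "Suc n"] unfolding a_def by (intro mult_left_mono) auto
    also have "\<dots> = (y (Suc (Suc n)) - y (Suc n)) * norm x"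
    proof -
      have "y (Suc (Suc n)) - y (Suc n) = (y (Suc n) + y n) / 2 * (y (Suc n) - y n)"
        unfolding y_Suc[of "Suc n"] by (subst (2) y_Suc) (simp add: field_simps power2_eq_square)
      then show ?thesis by simp
    qed
    finally show ?case .
  qed
  have Y_diff: "norm (Y (n + k) x - Y n x) \<le> (y (n + k) - y n) * norm x" for n k x
  proof (induction k)
    case (Suc k)
    have "norm (Y (n + Suc k) x - Y n x) \<le> norm (Y (Suc (n + k)) x - Y (n + k) x) + norm (Y (n + k) x - Y n x)"
      using norm_triangle_ineq[of "Y (Suc (n + k)) x - Y (n + k) x" "Y (n + k) x - Y n x"] by simp
    with Suc step[of "n + k" x] show ?case by (simp add: algebra_simps)
  qed simp
  have y_mono: "incseq y"
  proof (rule incseq_SucI)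
    fix n
    \<comment> \<open>The increment \<open>y (Suc n) - y n\<close> is
      \<open>(1 - y n)\<^sup>2 / 2\<close>.\<close>
    have "0 \<le> (1 - y n)\<^sup>2" by simp
    then show "y n \<le> y (Suc n)" by (simp add: y_Suc power2_eq_square algebra_simps)
  qed
  have "Cauchy y"
    using incseq_convergent[OF y_mono, of 1] y_bounds LIMSEQ_imp_Cauchy by metis
  have "Cauchy (\<lambda>n. Y n x)" for x
  proof (rule metric_CauchyI)
    fix e :: real assume "e > 0"
    then have "e / (norm x + 1) > 0" by (simp add: add_nonneg_pos)
    then obtain N where N: "\<And>m n. m \<ge> N \<Longrightarrow> n \<ge> N \<Longrightarrow> dist (y m) (y n) < e / (norm x + 1)"
      using metric_CauchyD[OF \<open>Cauchy y\<close>] by blast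
    have *: "dist (Y m x) (Y n x) < e" if "m \<ge> n" "n \<ge> N" for m n
    proof -
      have "dist (Y m x) (Y n x) \<le> (y m - y n) * norm x"
        using Y_diff[of n "m - n" x] that by (simp add: dist_norm)
      also have "\<dots> \<le> dist (y m) (y n) * (norm x + 1)"
        by (intro mult_mono) (auto simp: dist_real_def)
      also have "\<dots> < e"
        using N[of m n] that by (simp add: pos_less_divide_eq add_nonneg_pos)
      finally show ?thesis .
    qed
    show "\<exists>N. \<forall>m\<ge>N. \<forall>n\<ge>N. dist (Y m x) (Y n x) < e"
      using * by (intro exI[of _ N]) (metis dist_commute linear)
  qed
  then obtain Z where Z: "\<And>x. (\<lambda>n. Y n x) \<longlonglongrightarrow> Z x"
    unfolding Cauchy_convergent_iff convergent_def by metis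
  have Y_contr: "norm (Y n x) \<le> norm x" for n x
    using Y_norm[of n x] y_bounds[of n] by (meson mult_left_le_one_le norm_ge_zero order_trans)
  have ZB: "Z \<in> bounded_ops"
  proof (rule bounded_opsI[of _ 1])
    show "Z (a + b) = Z a + Z b" for a b
      using tendsto_add[OF Z[of a] Z[of b]] Z[of "a + b"]
      by (simp add: bounded_opsD(2)[OF YB, symmetric] LIMSEQ_unique)
    show "Z (c *\<^sub>C a) = c *\<^sub>C Z a" for c a
      using bounded_linear.tendsto[OF bounded_linear_scaleC Z, of c a] Z[of "c *\<^sub>C a"]
      by (simp add: bounded_opsD(7)[OF YB, symmetric] LIMSEQ_unique)
    show "norm (Z a) \<le> norm a * 1" for a
      using LIMSEQ_le_const2[OF tendsto_norm[OF Z[of a]]] Y_contr by simp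
  qed
  have "(\<lambda>n. Y n (Y n x)) \<longlonglongrightarrow> Z (Z x)" for x
  proof -
    \<comment> \<open>Split \<open>Y n (Y n x)\<close> as
      \<open>Y n (Y n x - Z x) + Y n (Z x)\<close>; the first summand vanishes in the limit because
      all \<open>Y n\<close> are contractions.\<close>
    have "(\<lambda>n. Y n (Y n x - Z x)) \<longlonglongrightarrow> 0"
    proof (rule Lim_null_comparison)
      show "(\<lambda>n. norm (Y n x - Z x)) \<longlonglongrightarrow> 0"
        using Z[of x] by (intro tendsto_norm_zero) (simp add: LIM_zero_iff)
    qed (simp add: Y_contr)
    from tendsto_add[OF this Z[of "Z x"]] show ?thesis
      by (simp add: bounded_opsD(3)[OF YB])
  qed
  then have "(\<lambda>n. Y (Suc n) x) \<longlonglongrightarrow> (1/2) *\<^sub>R (X x + Z (Z x))" for x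
    unfolding Y_Suc by (intro tendsto_intros)
  then have Z_eq: "Z x = (1/2) *\<^sub>R (X x + Z (Z x))" for x
    using LIMSEQ_Suc[OF Z] LIMSEQ_unique by blast
  have Z2: "Z x + Z x = X x + Z (Z x)" for x
    by (subst (1 2) Z_eq) (simp flip: scaleR_2)
  define B where "B = (\<lambda>x. x - Z x)"
  show thesis
  proof (rule that[of B])
    show "B \<in> bounded_ops"
      unfolding B_def using bounded_ops_diff[OF bounded_ops_id ZB] by simp
    have Z_sym: "inner (Z a) b = inner a (Z b)" for a b
    proof (rule LIMSEQ_unique)
      show "(\<lambda>n. inner (Y n a) b) \<longlonglongrightarrow> inner (Z a) b" by (intro tendsto_intros Z)
      show "(\<lambda>n. inner (Y n a) b) \<longlonglongrightarrow> inner a (Z b)"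
        unfolding Y_sym by (intro tendsto_intros Z)
    qed
    then show "inner (B a) b = inner a (B b)" for a b
      by (simp add: B_def inner_diff_left inner_diff_right)
    show "B (B x) = x - X x" for x
      using Z2[of x] by (simp add: B_def bounded_opsD(3)[OF ZB] algebra_simps)
    show "D (B x) = B (D x)" if D: "D \<in> bounded_ops" "\<And>x. D (X x) = X (D x)" for D x
    proof -
      have "(\<lambda>n. D (Y n x)) \<longlonglongrightarrow> D (Z x)"
        by (rule bounded_linear.tendsto[OF bounded_opsD(1)[OF D(1)] Z])
      then have "D (Z x) = Z (D x)"
        using Z[of "D x"] LIMSEQ_unique by (simp add: Y_comm[OF D])
      then show ?thesis by (simp add: B_def bounded_opsD(3)[OF D(1)])
    qed
  qed
qed

section \<open>Affiliated operators\<close>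

text \<open>The case of a single index, where the only matrix entry is the projection
  itself.\<close>

lemma projection_op_onto:
  fixes S :: "'a::complex_hilbert set"
  assumes S: "closed S" "csubspace S"
  obtains E where "projection_op E" "range E = S"
    "\<And>A x. A \<in> bounded_ops \<Longrightarrow> A ` S \<subseteq> S \<Longrightarrow> cadjoint A ` S \<subseteq> S \<Longrightarrow> E (A x) = A (E x)"
proof -
  interpret closed_subspace_of_sum "{()}" "{v. v () \<in> S}"
  proof
    show "v \<in> {v. v () \<in> S}"
      if "\<And>n. X n \<in> {v. v () \<in> S}" "\<And>i. i \<in> {()} \<Longrightarrow> (\<lambda>n. X n i) \<longlonglongrightarrow> v i"
      for X :: "nat \<Rightarrow> unit \<Rightarrow> 'a" and v
      using that closed_sequentially[OF S(1), of "\<lambda>n. X n ()" "v ()"] by simp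
  qed (use S(2) in \<open>auto simp: csubspace_def\<close>)
  define E where "E = entry () ()"
  have E: "E \<in> bounded_ops" by (simp add: E_def entry_bounded_ops)
  have in_S: "E x \<in> S" for x using proj_in[of "single () x"] by (simp add: E_def entry_def)
  have id: "E x = x" if "x \<in> S" for x
    using proj_id[of "single () x" "()"] that by (simp add: E_def entry_def single_def)
  show thesis
  proof (rule that[of E])
    show "projection_op E"
      using E in_S id by (auto simp: projection_op_def E_def cadjoint_entry)
    show "range E = S" using in_S id by (metis image_subsetI rangeI subsetI subset_antisym)
    show "E (A x) = A (E x)" if "A \<in> bounded_ops" "A ` S \<subseteq> S" "cadjoint A ` S \<subseteq> S" for A x
    proof -
      have "A \<circ> E = E \<circ> A"
        unfolding E_def by (rule entry_commute[OF that(1)]) (use that(2,3) in auto)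
      then show ?thesis by (simp add: fun_eq_iff)
    qed
  qed
qed

lemma sum_UNIV_bool: "(\<Sum>i\<in>UNIV. f i) = f False + f True"
  by (simp add: UNIV_bool)

text \<open>Multiplying by \<open>U\<close> from the left clears the adjoint.
  \<open>map_option\<close> records at once that \<open>U\<close> respects the domain in both
  directions and that it intertwines the values.\<close>

lemma mvn_affiliated_iff:
  "mvn_affiliated M T \<longleftrightarrow> (\<forall>U\<in>commutant M. unitary_op U \<longrightarrow> (\<forall>x. T (U x) = map_option U (T x)))"
proof -
  have "total_op (cadjoint U) \<circ>\<^sub>m T \<circ>\<^sub>m total_op U = T \<longleftrightarrow> (\<forall>x. T (U x) = map_option U (T x))"
    if U: "unitary_op U" for U
  proof -
    have "(total_op (cadjoint U) \<circ>\<^sub>m T \<circ>\<^sub>m total_op U) x = T x \<longleftrightarrow> T (U x) = map_option U (T x)" for x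
      using unitary_opD[OF U] by (cases "T (U x)"; cases "T x") (auto simp: map_comp_def total_op_def)
    then show ?thesis by (simp add: fun_eq_iff)
  qed
  then show ?thesis by (auto simp: mvn_affiliated_def)
qed

section \<open>Affiliation of quotients and of products
  \<open>P\<^sup>-\<^sup>1 A E\<^sup>\<dagger>\<close>\<close>

lemma unitary_range_iff:
  assumes "unitary_op U" "\<And>x. U (B x) = B (U x)"
  shows "U x \<in> range B \<longleftrightarrow> x \<in> range B"
proof
  assume "U x \<in> range B"
  then obtain z where "U x = B z" by blast
  then have "U x = U (B (cadjoint U z))"
    by (simp add: assms(2) unitary_opD[OF assms(1)])
  then have "x = B (cadjoint U z)" by (metis unitary_opD(2)[OF assms(1)])
  then show "x \<in> range B" by blast
next
  assume "x \<in> range B"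
  then show "U x \<in> range B" by (auto simp: assms(2))
qed

text \<open>\<open>U\<close> commutes with \<open>A\<close> and \<open>B\<close>, so it carries the
  graph element \<open>(B z, A z)\<close> to \<open>(B (U z), A (U z))\<close>.\<close>

lemma mvn_affiliated_quotient_op:
  assumes M: "M \<subseteq> bounded_ops" and AB: "A \<in> M" "B \<in> M" "null_space B \<subseteq> null_space A"
  shows "mvn_affiliated M (quotient_op A B)"
  unfolding mvn_affiliated_iff
proof (intro ballI impI allI)
  fix U x assume U: "U \<in> commutant M" "unitary_op U"
  note [simp] = commutantD[OF U(1) AB(1), symmetric] commutantD[OF U(1) AB(2), symmetric]
  have [simp]: "quotient_op A B (B z) = Some (A z)" for z
    using AB M by (intro quotient_op_apply) auto
  show "quotient_op A B (U x) = map_option U (quotient_op A B x)"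
  proof (cases "x \<in> range B")
    case True
    then obtain z where "x = B z" by blast
    then show ?thesis by simp
  next
    case False
    then have "U x \<notin> range B" using unitary_range_iff[OF U(2), of B] by simp
    with False show ?thesis by (simp add: quotient_op_def)
  qed
qed

lemma inverse_times_times_projection_apply:
  "(inverse_op P \<circ>\<^sub>m total_op A \<circ>\<^sub>m kaufman_inverse_proj E) x
    = (if x \<in> range E \<and> A x \<in> range P then Some (inv P (A x)) else None)"
  by (simp add: map_comp_def inverse_op_def total_op_def kaufman_inverse_proj_def restrict_map_def)

lemma mvn_affiliated_inverse_times_times_projection:
  assumes "P \<in> M" "A \<in> M" "E \<in> M" "inj P"
  shows "mvn_affiliated M (inverse_op P \<circ>\<^sub>m total_op A \<circ>\<^sub>m kaufman_inverse_proj E)"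
  unfolding mvn_affiliated_iff inverse_times_times_projection_apply
proof (intro ballI impI allI)
  fix U x assume U: "U \<in> commutant M" "unitary_op U"
  have comm: "A (U x) = U (A x)" "U (P z) = P (U z)" "U (E z) = E (U z)" for x z
    using commutantD[OF U(1)] assms by simp_all
  have *: "U x \<in> range E \<longleftrightarrow> x \<in> range E" "U y \<in> range P \<longleftrightarrow> y \<in> range P" for x y
    using unitary_range_iff[OF U(2)] comm by blast+
  have "inv P (U y) = U (inv P y)" if "y \<in> range P" for y
    using that by (auto simp: comm(2) assms(4))
  then show "(if U x \<in> range E \<and> A (U x) \<in> range P then Some (inv P (A (U x))) else None)
      = map_option U (if x \<in> range E \<and> A x \<in> range P then Some (inv P (A x)) else None)"
    by (simp add: comm(1) *)
qed

section \<open>The projection onto the graph of an affiliated closed operator\<close>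

locale mvn_affiliated_closed_op =
  fixes M :: "('a::complex_hilbert \<Rightarrow> 'a) set" and T :: "'a \<rightharpoonup> 'a"
  assumes M: "von_neumann_algebra M" and closed: "closed_op T" and mvn: "mvn_affiliated M T"
begin

lemma T_zero: "T 0 = Some 0"
  and T_add: "T x = Some y \<Longrightarrow> T x' = Some y' \<Longrightarrow> T (x + x') = Some (y + y')"
  and T_scaleC: "T x = Some y \<Longrightarrow> T (c *\<^sub>C x) = Some (c *\<^sub>C y)"
proof -
  have T: "csubspace (dom T)" "\<And>x y. x \<in> dom T \<Longrightarrow> y \<in> dom T \<Longrightarrow> the (T (x + y)) = the (T x) + the (T y)"
    "\<And>c x. x \<in> dom T \<Longrightarrow> the (T (c *\<^sub>C x)) = c *\<^sub>C the (T x)"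
    using closed by (auto simp: closed_op_def unbounded_op_def)
  show add: "T (x + x') = Some (y + y')" if "T x = Some y" "T x' = Some y'" for x y x' y'
  proof -
    have "x \<in> dom T" "x' \<in> dom T" using that by auto
    then have "x + x' \<in> dom T" using T(1) by (simp add: csubspace_def)
    then show ?thesis using T(2)[OF \<open>x \<in> dom T\<close> \<open>x' \<in> dom T\<close>] that by (auto simp: dom_def)
  qed
  show scale: "T (c *\<^sub>C x) = Some (c *\<^sub>C y)" if "T x = Some y" for c x y
  proof -
    have "x \<in> dom T" using that by auto
    then have "c *\<^sub>C x \<in> dom T" using T(1) by (simp add: csubspace_def)
    then show ?thesis using T(3)[OF \<open>x \<in> dom T\<close>, of c] that by (auto simp: dom_def)
  qed
  obtain y where "T 0 = Some y" using T(1) by (auto simp: csubspace_def)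
  then show "T 0 = Some 0" using scale[of 0 y 0] by simp
qed

lemma T_diff: "T x = Some y \<Longrightarrow> T x' = Some y' \<Longrightarrow> T (x - x') = Some (y - y')"
  using T_add[of x y "(-1) *\<^sub>C x'"] T_scaleC[of x' y' "-1"] by simp

lemma T_lim:
  assumes "\<And>n. T (X n) = Some (Y n)" "X \<longlonglongrightarrow> x" "Y \<longlonglongrightarrow> y"
  shows "T x = Some y"
proof -
  have "closed (Map.graph T)" using closed by (simp add: closed_op_def)
  from closed_sequentially[OF this, of "\<lambda>n. (X n, Y n)" "(x, y)"] assms show ?thesis
    by (auto simp: Map.graph_def intro: tendsto_Pair)
qed

lemma T_unitary: "U \<in> commutant M \<Longrightarrow> unitary_op U \<Longrightarrow> T (U x) = map_option U (T x)"
  using mvn by (simp add: mvn_affiliated_iff)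

lemma M_closed: "M \<subseteq> bounded_ops" "A \<in> M \<Longrightarrow> cadjoint A \<in> M"
  using M by (simp_all add: von_neumann_algebra_def)

lemma in_M: "X \<in> bounded_ops \<Longrightarrow> (\<And>U x. U \<in> commutant M \<Longrightarrow> unitary_op U \<Longrightarrow> X (U x) = U (X x)) \<Longrightarrow> X \<in> M"
  using in_von_neumann_algebra_if_commute_unitaries[OF M] by blast

text \<open>
  The graph of \<open>T\<close> in the sum of two copies of the Hilbert space; index \<open>True\<close> is the domain copy.
\<close>

sublocale closed_subspace_of_sum "UNIV :: bool set" "{v. T (v True) = Some (v False)}"
proof
  show "v \<in> {v. T (v True) = Some (v False)}"
    if "\<And>n. X n \<in> {v. T (v True) = Some (v False)}" "\<And>i. i \<in> UNIV \<Longrightarrow> (\<lambda>n. X n i) \<longlonglongrightarrow> v i"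
    for X :: "nat \<Rightarrow> bool \<Rightarrow> 'a" and v
    using that T_lim[of "\<lambda>n. X n True" "\<lambda>n. X n False" "v True" "v False"] by simp
qed (auto simp: T_zero T_add T_scaleC)

text \<open>Affiliation makes both \<open>U\<close> and its adjoint preserve the graph, so
  \<open>U\<close> commutes with the projection onto it.\<close>

lemma entry_unitary:
  assumes "U \<in> commutant M" "unitary_op U"
  shows "entry i j (U x) = U (entry i j x)"
proof -
  note c = commutant_cadjoint[OF M_closed assms(1)] unitary_op_cadjoint[OF assms(2)]
  have "U \<circ> entry i j = entry i j \<circ> U"
    by (rule entry_commute[OF unitary_opD(1)[OF assms(2)]]) (auto simp: T_unitary[OF assms] T_unitary[OF c])
  then show ?thesis by (simp add: fun_eq_iff)
qed

lemma entry_in_M: "entry i j \<in> M"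
  by (intro in_M entry_bounded_ops entry_unitary) auto

text \<open>These are the two coordinates of the projection of \<open>(z, 0)\<close> onto the graph.
  In the notation \<open>p\<^sub>i\<^sub>j\<close>, \<open>True\<close> is index 1 and
  \<open>False\<close> is index 2.\<close>

lemma T_entry: "T (entry True True z) = Some (entry False True z)"
  using proj_in[of "single True z"] by (simp add: entry_def)

text \<open>The equation says that \<open>(x, y)\<close> and its projection \<open>(a, y)\<close>
  share the second coordinate. Then \<open>x - a\<close> is orthogonal to \<open>dom T\<close> and
  lies in its closure, so it is 0.\<close>

lemma T_iff_entry:
  "T x = Some y \<longleftrightarrow> x \<in> closure (dom T) \<and> y - entry False False y = entry False True x"
proof -
  define u where "u = (\<lambda>b. if b then x else y)"
  have proj_u: "proj u i = entry i False y + entry i True x" for i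
    by (simp add: proj_eq_sum_entry sum_UNIV_bool u_def)
  show ?thesis
  proof (intro iffI conjI; (elim conjE)?)
    assume T: "T x = Some y"
    then show "x \<in> closure (dom T)" using closure_subset[of "dom T"] domI[of T x y] by auto
    show "y - entry False False y = entry False True x"
      using proj_u[of False] proj_id[of u False] T by (simp add: u_def algebra_simps)
  next
    assume x: "x \<in> closure (dom T)" and "y - entry False False y = entry False True x"
    then have y: "proj u False = y" unfolding proj_u by (simp add: algebra_simps)
    define a where "a = proj u True"
    have a: "T a = Some y" using proj_in[of u] y by (simp add: a_def)
    have orth: "inner (x - a) w = 0" if w: "w \<in> dom T" for w
    proof -
      obtain w' where "T w = Some w'" using w by blast
      then show ?thesis
        using proj_orth[of "\<lambda>b. if b then w else w'" u] y by (simp add: sum_UNIV_bool u_def a_def)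
    qed
    have "csubspace (dom T)" using closed by (simp add: closed_op_def unbounded_op_def)
    then have "subspace (closure (dom T))"
      by (intro subspace_closure subspace_if_csubspace)
    moreover have "a \<in> closure (dom T)" using a closure_subset[of "dom T"] domI[of T a y] by auto
    ultimately have "x - a \<in> closure (dom T)" using x by (simp add: subspace_diff)
    also have "closure (dom T) \<subseteq> {w. inner (x - a) w = 0}"
      by (rule closure_minimal) (auto intro!: orth closed_Collect_eq continuous_intros)
    finally have "x = a" by simp
    with a show "T x = Some y" by simp
  qed
qed

lemma inverse_times_times_projection_exists:
  "\<exists>P\<in>M. \<exists>A\<in>M. \<exists>E\<in>M. positive_op P \<and> inj P \<and> closure (range P) = UNIV \<and> projection_op E \<and>
     T = inverse_op P \<circ>\<^sub>m total_op A \<circ>\<^sub>m kaufman_inverse_proj E"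
proof -
  define P where "P = (\<lambda>y. y - entry False False y)"
  have PB: "P \<in> bounded_ops"
    unfolding P_def using bounded_ops_diff[OF bounded_ops_id entry_bounded_ops[of False False]] by simp
  have P_sym: "inner (P x) y = inner x (P y)" for x y
    by (simp add: P_def inner_diff_left inner_diff_right inner_entry)
  have "P \<in> M"
    by (intro in_M PB) (simp add: P_def entry_unitary bounded_opsD(3)[OF unitary_opD(1)])
  moreover have "positive_op P"
  proof (rule positive_opI[OF PB P_sym])
    show "0 \<le> inner (P x) x" for x
      using sum_norm_entry_le[of False x]
      by (simp add: P_def inner_diff_left inner_entry_self[of False] power2_norm_eq_inner[of x])
  qed
  \<comment> \<open>\<open>P x = 0\<close> puts the pair \<open>(0, x)\<close> into the graph, and
    the value of \<open>T\<close> at 0 is 0.\<close>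
  moreover have P0: "x = 0" if "P x = 0" for x
  proof -
    have "T 0 = Some x"
      using T_iff_entry[of 0 0] T_iff_entry[of 0 x] that by (simp add: T_zero P_def bounded_opsD(5)[OF entry_bounded_ops])
    then show ?thesis by (simp add: T_zero)
  qed
  have "inj P"
    by (rule injI) (metis P0 bounded_opsD(3)[OF PB] right_minus_eq)
  \<comment> \<open>A vector orthogonal to the range of the symmetric \<open>P\<close> lies in its
    kernel, which is trivial.\<close>
  moreover have "closure (range P) = UNIV"
  proof (rule closure_UNIV_if_orthogonal_zero)
    show "subspace (range P)"
      by (rule linear_subspace_image[OF bounded_linear.linear[OF bounded_opsD(1)[OF PB]] subspace_UNIV])
    show "x = 0" if "\<And>w. w \<in> range P \<Longrightarrow> inner x w = 0" for x
    proof (rule P0)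
      have "inner (P x) (P x) = 0" using that[of "P (P x)"] by (simp add: P_sym)
      then show "P x = 0" by simp
    qed
  qed
  moreover obtain E where E: "projection_op E" "range E = closure (dom T)"
    "\<And>A x. A \<in> bounded_ops \<Longrightarrow> A ` closure (dom T) \<subseteq> closure (dom T) \<Longrightarrow>
      cadjoint A ` closure (dom T) \<subseteq> closure (dom T) \<Longrightarrow> E (A x) = A (E x)"
    using projection_op_onto[of "closure (dom T)"] closed csubspace_closure
    by (metis closed_closure closed_op_def unbounded_op_def)
  moreover have "E \<in> M"
  proof (rule in_M)
    show "E \<in> bounded_ops" using E(1) by (simp add: projection_op_def)
    have inv: "U ` closure (dom T) \<subseteq> closure (dom T)" if U: "U \<in> commutant M" "unitary_op U" for U
    proof (rule image_closure_subset)
      show "continuous_on (closure (dom T)) U"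
        using bounded_opsD(1)[OF unitary_opD(1)[OF U(2)]] by (rule linear_continuous_on)
      show "U ` dom T \<subseteq> closure (dom T)"
        using T_unitary[OF U] closure_subset[of "dom T"] by (auto simp: dom_def)
    qed simp
    fix U x assume U: "U \<in> commutant M" "unitary_op U"
    show "E (U x) = U (E x)"
      by (rule E(3)[OF unitary_opD(1)[OF U(2)] inv[OF U]
            inv[OF commutant_cadjoint[OF M_closed U(1)] unitary_op_cadjoint[OF U(2)]]])
  qed
  moreover have "T = inverse_op P \<circ>\<^sub>m total_op (entry False True) \<circ>\<^sub>m kaufman_inverse_proj E"
  proof
    fix x
    show "T x = (inverse_op P \<circ>\<^sub>m total_op (entry False True) \<circ>\<^sub>m kaufman_inverse_proj E) x"
    proof (cases "T x")
      case None
      then have "\<not> (x \<in> closure (dom T) \<and> P y = entry False True x)" for y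
        using T_iff_entry[of x y] by (simp add: P_def)
      then show ?thesis
        using None by (auto simp: inverse_times_times_projection_apply E(2)) metis
    next
      case (Some y)
      then have "x \<in> range E" "entry False True x = P y"
        using T_iff_entry[of x y] by (simp_all add: P_def E(2))
      then show ?thesis
        using Some \<open>inj P\<close> by (simp add: inverse_times_times_projection_apply)
    qed
  qed
  ultimately show ?thesis using entry_in_M by blast
qed

text \<open>\<open>TB\<close> and \<open>dom_sub\<close> are the two inclusions between
  \<open>range B\<close> and \<open>dom T\<close>. \<open>TB\<close> also shows that
  \<open>A = T B\<close> is bounded, and \<open>A\<close> commutes with the unitaries of the
  commutant because \<open>T\<close> and \<open>B\<close> do.\<close>

lemma in_affiliated_ops: "T \<in> affiliated_ops M"
proof -
  let ?p = "entry True True" and ?q = "entry False True"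
  have pB: "?p \<in> bounded_ops" and qB: "?q \<in> bounded_ops"
    by (simp_all add: entry_bounded_ops)
  \<comment> \<open>\<open>X\<close> is a symmetric contraction, so there is a self-adjoint root of
    \<open>1 - X\<close>, which is \<open>?p\<close>.\<close>
  define X where "X = (\<lambda>x. x - ?p x)"
  have XB: "X \<in> bounded_ops"
    unfolding X_def using bounded_ops_diff[OF bounded_ops_id pB] by simp
  have X_sym: "inner (X x) y = inner x (X y)" for x y
    by (simp add: X_def inner_diff_left inner_diff_right inner_entry)
  obtain B where B: "B \<in> bounded_ops" "\<And>x y. inner (B x) y = inner x (B y)" "\<And>x. B (B x) = x - X x"
    "\<And>D x. D \<in> bounded_ops \<Longrightarrow> (\<And>x. D (X x) = X (D x)) \<Longrightarrow> D (B x) = B (D x)"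
    using sqrt_one_minus_contraction[OF XB _ X_sym] norm_diff_entry_le[of True] unfolding X_def by blast
  have BB: "B (B x) = ?p x" for x by (simp add: B(3) X_def)
  have B_unitary: "B (U x) = U (B x)" if "U \<in> commutant M" "unitary_op U" for U x
    using unitary_opD(1)[OF that(2)]
    by (intro B(4)[symmetric]) (simp_all add: X_def bounded_opsD(3) entry_unitary[OF that])
  have "B \<in> M" using B_unitary by (intro in_M B(1))
  have norm_B: "(norm (B z))\<^sup>2 = (norm (?p z))\<^sup>2 + (norm (?q z))\<^sup>2" for z
    using inner_entry_self[of True z] by (simp add: power2_norm_eq_inner[of "B z"] B(2) BB inner_commute sum_UNIV_bool)
  have q_le: "norm (?q z) \<le> norm (B z)" for z
    by (rule power2_le_imp_le) (simp_all add: norm_B)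
  \<comment> \<open>For \<open>x = B z\<close>, the value of \<open>T\<close> at
    \<open>B x = ?p z\<close> is \<open>?q z\<close>, of norm at most \<open>norm (B z)\<close>.
    Closedness of \<open>T\<close> extends this to limits of such \<open>x\<close>.\<close>
  have TB_closure: "\<exists>y. T (B x) = Some y \<and> norm y \<le> norm x" if x: "x \<in> closure (range B)" for x
  proof -
    obtain X where X: "\<And>n. X n \<in> range B" "X \<longlonglongrightarrow> x" using x unfolding closure_sequential by blast
    then have "\<forall>n. \<exists>z. X n = B z" by blast
    then obtain z where z: "\<And>n. X n = B (z n)" by metis
    have lim: "(\<lambda>n. B (z n)) \<longlonglongrightarrow> x" using X(2) by (simp add: z[symmetric])
    then have p: "(\<lambda>n. ?p (z n)) \<longlonglongrightarrow> B x"
      unfolding BB[symmetric] by (rule bounded_linear.tendsto[OF bounded_opsD(1)[OF B(1)]])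
    have "Cauchy (\<lambda>n. ?q (z n))"
    proof (rule metric_CauchyI)
      fix e :: real assume "e > 0"
      then obtain N where N: "\<forall>m\<ge>N. \<forall>n\<ge>N. dist (B (z m)) (B (z n)) < e"
        using metric_CauchyD[OF LIMSEQ_imp_Cauchy[OF lim]] by blast
      have "dist (?q (z m)) (?q (z n)) \<le> dist (B (z m)) (B (z n))" for m n
        using q_le[of "z m - z n"] by (simp add: dist_norm bounded_opsD(3)[OF B(1)] bounded_opsD(3)[OF qB])
      then show "\<exists>N. \<forall>m\<ge>N. \<forall>n\<ge>N. dist (?q (z m)) (?q (z n)) < e"
        using N by (meson le_less_trans)
    qed
    then obtain y where y: "(\<lambda>n. ?q (z n)) \<longlonglongrightarrow> y" by (auto simp: Cauchy_convergent_iff convergent_def)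
    have "T (B x) = Some y" by (rule T_lim[OF T_entry p y])
    moreover have "norm y \<le> norm x"
      by (rule LIMSEQ_le[OF tendsto_norm[OF y] tendsto_norm[OF lim]]) (auto simp: q_le)
    ultimately show ?thesis by blast
  qed
  \<comment> \<open>The component of \<open>w\<close> orthogonal to \<open>range B\<close> is
    annihilated by the symmetric \<open>B\<close>, so \<open>w\<close> may be replaced by its
    projection, which is no longer than \<open>w\<close>.\<close>
  have TB: "\<exists>y. T (B w) = Some y \<and> norm y \<le> norm w" for w
  proof -
    have sub: "subspace (closure (range B))"
      by (rule subspace_closure[OF linear_subspace_image[OF bounded_linear.linear[OF bounded_opsD(1)[OF B(1)]] subspace_UNIV]])
    obtain x where x: "x \<in> closure (range B)" "\<And>v. v \<in> closure (range B) \<Longrightarrow> inner (w - x) v = 0"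
      using projection_exists[OF closed_closure sub, of w] by blast
    have "inner (B (w - x)) (B (w - x)) = 0"
      using x(2)[of "B (B (w - x))"] closure_subset[of "range B"] by (auto simp: B(2))
    then have "B w = B x" by (simp add: bounded_opsD(3)[OF B(1)])
    moreover have "norm x \<le> norm w"
    proof (rule power2_le_imp_le)
      have "(norm w)\<^sup>2 = (norm x)\<^sup>2 + (norm (w - x))\<^sup>2 + 2 * inner (w - x) x"
        unfolding power2_norm_eq_inner by (simp add: algebra_simps inner_commute)
      then show "(norm x)\<^sup>2 \<le> (norm w)\<^sup>2" using x(2)[OF x(1)] by simp
    qed simp
    ultimately show ?thesis using TB_closure[OF x(1)] by (metis order_trans)
  qed
  have dom_sub: "a \<in> range B" if a: "T a = Some b" for a b
  proof -
    \<comment> \<open>The projections of all \<open>(z, 0)\<close> onto the graph. The point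
      \<open>c\<close> of \<open>closure L\<close> nearest to \<open>(a, b)\<close> will turn out to
      have first coordinate \<open>a\<close>.\<close>
    define L where "L = range (\<lambda>z. (?p z, ?q z))"
    have "linear (\<lambda>z. (?p z, ?q z))"
      by (intro bounded_linear.linear bounded_linear_Pair bounded_opsD(1) pB qB)
    then have "subspace L" unfolding L_def by (rule linear_subspace_image[OF _ subspace_UNIV])
    then obtain c where c: "c \<in> closure L" "\<And>w. w \<in> closure L \<Longrightarrow> inner ((a, b) - c) w = 0"
      using projection_exists[OF closed_closure subspace_closure[of L], of "(a, b)"] by metis
    obtain c1 c2 where c_eq: "c = (c1, c2)" by force
    obtain W where W: "\<And>n. W n \<in> L" "W \<longlonglongrightarrow> c" using c(1) unfolding closure_sequential by blast
    then have "\<forall>n. \<exists>z. W n = (?p z, ?q z)" unfolding L_def by blast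
    from choice[OF this] obtain z where z: "\<And>n. W n = (?p (z n), ?q (z n))" by blast
    have lim: "(\<lambda>n. ?p (z n)) \<longlonglongrightarrow> c1" "(\<lambda>n. ?q (z n)) \<longlonglongrightarrow> c2"
      using tendsto_fst[OF W(2)] tendsto_snd[OF W(2)] by (simp_all add: z c_eq)
    have "T c1 = Some c2" by (rule T_lim[OF T_entry lim])
    then have "T (a - c1) = Some (b - c2)" using a by (intro T_diff)
    then have V: "(\<lambda>i. if i then a - c1 else b - c2) \<in> {v. T (v True) = Some (v False)}" (is "?v \<in> _") by simp
    have "inner (a - c1) x = 0" for x
    proof -
      \<comment> \<open>\<open>?v\<close> lies in the graph, so pairing it with
        \<open>(x, 0)\<close> is the same as pairing it with the projection of
        \<open>(x, 0)\<close>, which belongs to \<open>L\<close>.\<close>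
      have "(\<Sum>i\<in>UNIV. inner (single True x i) (?v i)) = (\<Sum>i\<in>UNIV. inner (entry i True x) (?v i))"
        using proj_orth[OF V, of "single True x"] by (simp add: inner_diff_left sum_subtractf entry_def)
      also have "\<dots> = inner ((a, b) - c) (?p x, ?q x)"
        by (simp add: sum_UNIV_bool c_eq inner_commute)
      also have "\<dots> = 0" using closure_subset[of L] by (intro c(2)) (auto simp: L_def)
      finally show ?thesis by (simp add: sum_UNIV_bool single_def inner_commute)
    qed
    then have "a = c1" by (metis inner_eq_zero_iff right_minus_eq)
    \<comment> \<open>\<open>B x\<close> has the norm of the pair \<open>(?p x, ?q x)\<close>, so
      convergence of \<open>W\<close> makes \<open>B (z n)\<close> converge; \<open>B\<close> sends
      its limit to \<open>c1\<close>.\<close>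
    have "Cauchy (\<lambda>n. B (z n))"
    proof (rule metric_CauchyI)
      fix e :: real assume "e > 0"
      then obtain N where N: "\<forall>m\<ge>N. \<forall>n\<ge>N. dist (W m) (W n) < e"
        using metric_CauchyD[OF LIMSEQ_imp_Cauchy[OF W(2)]] by blast
      have "norm (B x) = norm (?p x, ?q x)" for x
        by (rule power2_eq_imp_eq) (simp_all add: norm_B norm_Pair)
      from this[of "z _ - z _"] have "dist (B (z m)) (B (z n)) = dist (W m) (W n)" for m n
        by (simp add: dist_norm z bounded_opsD(3)[OF B(1)] bounded_opsD(3)[OF qB] bounded_opsD(3)[OF pB])
      then show "\<exists>N. \<forall>m\<ge>N. \<forall>n\<ge>N. dist (B (z m)) (B (z n)) < e"
        using N by metis
    qed
    then obtain x where "(\<lambda>n. B (z n)) \<longlonglongrightarrow> x" by (auto simp: Cauchy_convergent_iff convergent_def)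
    from bounded_linear.tendsto[OF bounded_opsD(1)[OF B(1)] this] have "(\<lambda>n. ?p (z n)) \<longlonglongrightarrow> B x"
      by (simp add: BB)
    then have "B x = c1" using lim(1) LIMSEQ_unique by blast
    with \<open>a = c1\<close> show ?thesis by blast
  qed
  define A where "A = (\<lambda>x. the (T (B x)))"
  have A: "T (B x) = Some (A x)" "norm (A x) \<le> norm x" for x
    using TB[of x] by (auto simp: A_def)
  have AI: "A x = y" if "T (B x) = Some y" for x y using that by (simp add: A_def)
  have AB: "A \<in> bounded_ops"
    by (rule bounded_opsI[of _ 1]; (intro AI)?)
      (simp_all add: A bounded_opsD(2,7)[OF B(1)] T_add T_scaleC)
  have "A \<in> M"
    by (intro in_M AB AI) (simp add: B_unitary T_unitary A)
  moreover have "null_space B \<subseteq> null_space A"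
    by (auto simp: null_space_def intro: AI simp: T_zero)
  moreover have "T = quotient_op A B"
  proof
    fix y
    show "T y = quotient_op A B y"
      using dom_sub[of y] A(1)[of "inv B y"]
      by (cases "T y") (auto simp: quotient_op_def f_inv_into_f A(1))
  qed
  ultimately show ?thesis using \<open>B \<in> M\<close> unfolding affiliated_ops_def by blast
qed

end

theorem theorem5p4:
  fixes M :: "('a::complex_hilbert \<Rightarrow> 'a) set"
    and T :: "'a \<rightharpoonup> 'a"
  assumes "von_neumann_algebra M"
    and "closed_op T"
  shows "((mvn_affiliated M T \<longleftrightarrow> T \<in> affiliated_ops M)
          \<and> mvn_affiliated_ops M = closed_affiliated_ops M)
       \<and> (T \<in> closed_affiliated_ops M \<longleftrightarrow>
           (\<exists>P\<in>M. \<exists>A\<in>M. \<exists>E\<in>M.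
              positive_op P \<and> inj P \<and> closure (range P) = UNIV \<and> projection_op E \<and>
              T = inverse_op P \<circ>\<^sub>m total_op A \<circ>\<^sub>m kaufman_inverse_proj E))"
proof -
  have "M \<subseteq> bounded_ops" using assms(1) by (simp add: von_neumann_algebra_def)
  then have iff: "mvn_affiliated M S \<longleftrightarrow> S \<in> affiliated_ops M" if "closed_op S" for S
    using mvn_affiliated_closed_op.in_affiliated_ops[OF mvn_affiliated_closed_op.intro, OF assms(1) that]
      mvn_affiliated_quotient_op
    by (auto simp: affiliated_ops_def)
  then have eq: "mvn_affiliated_ops M = closed_affiliated_ops M"
    by (auto simp: mvn_affiliated_ops_def closed_affiliated_ops_def)
  have "T \<in> closed_affiliated_ops M \<longleftrightarrow> mvn_affiliated M T"
    using eq assms(2) by (auto simp: mvn_affiliated_ops_def)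
  also have "\<dots> \<longleftrightarrow> (\<exists>P\<in>M. \<exists>A\<in>M. \<exists>E\<in>M.
      positive_op P \<and> inj P \<and> closure (range P) = UNIV \<and> projection_op E \<and>
      T = inverse_op P \<circ>\<^sub>m total_op A \<circ>\<^sub>m kaufman_inverse_proj E)"
    using mvn_affiliated_closed_op.inverse_times_times_projection_exists[OF mvn_affiliated_closed_op.intro, OF assms]
      mvn_affiliated_inverse_times_times_projection
    by blast
  finally show ?thesis using iff[OF assms(2)] eq by blast
qed

end
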